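(* Let $p$ be a prime, $n\ge 1$, $x_0,a_0,a_1,\ldots,a_n\in\mathbb{Q}_p$ with $a_n\neq 0$, and $r\in\mathbb{Z}$. Then $$\left|\int_{|x-x_0|\le p^r}\chi(a_0+a_1x+\dots+a_nx^n)\,dx\right|\le\frac{2p^{n}}{|a_n|^{1/n}}.$$
   Context: $|\cdot|$ denotes the $p$-adic absolute value on $\mathbb{Q}_p$. Every nonzero $x\in\mathbb{Q}_p$ has a unique standard expansion $x=\sum_{j=k}^\infty x_jp^j$ with $x_j\in\{0,\ldots,p-1\}$, $x_k\neq 0$, $|x|=p^{-k}$. The additive character $\chi:\mathbb{Q}_p\to\mathbb{C}$ is $\chi(x)=\exp\!\big(2\pi i\sum_{j=k}^{-1}x_jp^j\big)$ if $|x|>1$ and $\chi(x)=1$ if $|x|\le 1$. $dx$ is the Haar measure on $\mathbb{Q}_p$ normalized so that each ball $\{x:|x-x_0|\le p^r\}$ has measure $p^r$. *)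

theory Defs
  imports "HOL-Analysis.Analysis" "HOL-Computational_Algebra.Factorial_Ring"
begin

definition padic_val_rat :: "nat \<Rightarrow> rat \<Rightarrow> int" where
  "padic_val_rat p q = (case quotient_of q of (a, b) \<Rightarrow>
      int (multiplicity (int p) a) - int (multiplicity (int p) b))"

definition pabs_rat :: "nat \<Rightarrow> rat \<Rightarrow> real" where
  "pabs_rat p q = (if q = 0 then 0 else real p powi (- padic_val_rat p q))"

definition pcauchy :: "nat \<Rightarrow> (nat \<Rightarrow> rat) \<Rightarrow> bool" where
  "pcauchy p f \<longleftrightarrow> (\<forall>e>0. \<exists>N. \<forall>m\<ge>N. \<forall>n\<ge>N. pabs_rat p (f m - f n) < e)"

definition pnull :: "nat \<Rightarrow> (nat \<Rightarrow> rat) \<Rightarrow> bool" where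
  "pnull p f \<longleftrightarrow> (\<forall>e>0. \<exists>N. \<forall>n\<ge>N. pabs_rat p (f n) < e)"

text \<open>An element of Q_p is an equivalence class of p-adic Cauchy sequences.\<close>
type_synonym qp = "(nat \<Rightarrow> rat) set"

definition pcls :: "nat \<Rightarrow> (nat \<Rightarrow> rat) \<Rightarrow> qp" where
  "pcls p f = {g. pcauchy p g \<and> pnull p (\<lambda>n. f n - g n)}"

definition Qp :: "nat \<Rightarrow> qp set" where
  "Qp p = {pcls p f | f. pcauchy p f}"

definition prep :: "qp \<Rightarrow> (nat \<Rightarrow> rat)" where
  "prep x = (SOME f. f \<in> x)"

definition pof_rat :: "nat \<Rightarrow> rat \<Rightarrow> qp" where
  "pof_rat p q = pcls p (\<lambda>_. q)"

definition padd :: "nat \<Rightarrow> qp \<Rightarrow> qp \<Rightarrow> qp" where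
  "padd p x y = pcls p (\<lambda>n. prep x n + prep y n)"

definition psub :: "nat \<Rightarrow> qp \<Rightarrow> qp \<Rightarrow> qp" where
  "psub p x y = pcls p (\<lambda>n. prep x n - prep y n)"

definition pmul :: "nat \<Rightarrow> qp \<Rightarrow> qp \<Rightarrow> qp" where
  "pmul p x y = pcls p (\<lambda>n. prep x n * prep y n)"

definition pabs :: "nat \<Rightarrow> qp \<Rightarrow> real" where
  "pabs p x = lim (\<lambda>n. pabs_rat p (prep x n))"

primrec ppow :: "nat \<Rightarrow> qp \<Rightarrow> nat \<Rightarrow> qp" where
  "ppow p x 0 = pof_rat p 1"
| "ppow p x (Suc k) = pmul p x (ppow p x k)"

primrec psum :: "nat \<Rightarrow> (nat \<Rightarrow> qp) \<Rightarrow> nat \<Rightarrow> qp" where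
  "psum p f 0 = pof_rat p 0"
| "psum p f (Suc k) = padd p (psum p f k) (f k)"

definition ppoly :: "nat \<Rightarrow> (nat \<Rightarrow> qp) \<Rightarrow> nat \<Rightarrow> qp \<Rightarrow> qp" where
  "ppoly p a n x = psum p (\<lambda>i. pmul p (a i) (ppow p x i)) (Suc n)"

text \<open>Partial sum  sum_{j <= M} d_j p^j  of a digit sequence (finitely many nonzero terms
  when the digits vanish below some index).\<close>
definition pdigit_sum :: "nat \<Rightarrow> (int \<Rightarrow> nat) \<Rightarrow> int \<Rightarrow> rat" where
  "pdigit_sum p d M = (\<Sum>j\<in>{j. j \<le> M \<and> d j \<noteq> 0}. of_nat (d j) * (of_nat p) powi j)"

definition is_std_expansion :: "nat \<Rightarrow> qp \<Rightarrow> (int \<Rightarrow> nat) \<Rightarrow> bool" where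
  "is_std_expansion p x d \<longleftrightarrow>
     (\<forall>j. d j < p) \<and> (\<exists>k. \<forall>j<k. d j = 0) \<and>
     (\<forall>e>0. \<exists>N. \<forall>M\<ge>N. pabs p (psub p x (pof_rat p (pdigit_sum p d M))) < e)"

definition pdigits :: "nat \<Rightarrow> qp \<Rightarrow> int \<Rightarrow> nat" where
  "pdigits p x = (THE d. is_std_expansion p x d)"

definition pchi :: "nat \<Rightarrow> qp \<Rightarrow> complex" where
  "pchi p x = (if pabs p x \<le> 1 then 1
     else cis (2 * pi * real_of_rat (pdigit_sum p (pdigits p x) (-1))))"

definition pball :: "nat \<Rightarrow> qp \<Rightarrow> int \<Rightarrow> qp set" where
  "pball p x0 r = {x \<in> Qp p. pabs p (psub p x x0) \<le> real p powi r}"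

text \<open>The (Borel) sigma algebra of Q_p is generated by the balls; dx is the measure on it
  giving every ball of radius p^r measure p^r.\<close>
definition haar :: "nat \<Rightarrow> qp measure" where
  "haar p = (THE M. space M = Qp p \<and>
      sets M = sigma_sets (Qp p) {pball p x r | x r. x \<in> Qp p} \<and>
      (\<forall>x\<in>Qp p. \<forall>r. emeasure M (pball p x r) = ennreal (real p powi r)))"

end

(*
  On balls of small enough radius the integrand is constant, so the integral is a finite
  exponential sum p^(r-K) sum_{t < p^K} e(P(t)/p^N) with P an integer polynomial of degree n.
  Let p^w be the largest power of p dividing P', and let m be the degree of P'/p^w modulo p.
  If m = 0 and w + 2 <= N, the substitution t -> t + p^(N-w-1) multiplies the sum by a
  nontrivial root of unity, so it vanishes.  Otherwise split t = y + p t'.  Every child P(y + p t')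
  has degree at most m in the same sense, and if one of them attains m then P'/p^w is congruent to
  c (t - y)^m modulo p, so all the other children have degree 0 and vanish.  Hence after s splittings
  the sum is at most p^(K-s) p^(m-1), where m <= n - 1, as long as the
  rescaled leading coefficient has |n a_n| >= p^2 on the smaller balls; the largest such s gives p^n |a_n|^(-1/n).
*)
theory Submission
  imports Defs "HOL-Computational_Algebra.Polynomial"
begin

section \<open>Complete exponential sums modulo prime powers\<close>

text \<open>The derivative is measured instead of \<open>P\<close> because modulo \<open>p^N\<close>
  a shift by \<open>p^(N-w-1)\<close> acts only through its linear term. The obstacle is an exponent
  \<open>k\<close> divisible by \<open>p\<close>, where \<open>P'\<close> says too little about
  \<open>coeff P k\<close>; the missing factors come back from \<open>(t + h)^k - t^k\<close>. Of
  the coefficients only the top one is followed through the splittings: it bounds \<open>w\<close>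
  by the valuation of \<open>n * lead_coeff P\<close>, and each splitting raises that valuation by
  exactly \<open>n\<close>. This is the origin of the root \<open>1/n\<close>. A node with several
  surviving children costs a factor \<open>p\<close> but lowers \<open>m\<close>, so all branchings
  together cost at most \<open>p^(m-1)\<close>, hence at most \<open>p^(n-2)\<close>. The two
  further powers of \<open>p\<close> pay for rounding \<open>s\<close>, for the threshold
  \<open>w + 2 \<le> N\<close>, and for the valuation of \<open>n\<close>, which is at most
  \<open>n - 1\<close>. On the analytic side the digits and \<open>haar\<close> are definite
  descriptions, so existence and uniqueness come before any use. The measure is the image of
  Lebesgue measure under reflection of base-\<open>p\<close> digits, and the character is evaluated
  on the dense ring of fractions with denominator a power of \<open>p\<close>.\<close>

lemma sum_lessThan_shift_periodic:
  fixes f :: "nat \<Rightarrow> 'a::ab_group_add"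
  assumes "\<And>t. f (t + M) = f t"
  shows "(\<Sum>t<M. f (t + h)) = (\<Sum>t<M. f t)"
proof (induction h)
  case (Suc h)
  have "(\<Sum>t<M. f (Suc t + h)) + f h = (\<Sum>t<Suc M. f (t + h))"
    by (subst sum.lessThan_Suc_shift) (simp add: add.commute)
  also have "\<dots> = (\<Sum>t<M. f (t + h)) + f h"
    using assms[of h] by (simp add: add.commute)
  finally show ?case using Suc by simp
qed simp

lemma sum_lessThan_mult_nat:
  fixes f :: "nat \<Rightarrow> 'a::comm_monoid_add"
  shows "(\<Sum>t<p * M. f t) = (\<Sum>y<p. \<Sum>t<M. f (y + p * t))"
proof (induction M)
  case (Suc M)
  have "{..<p * Suc M} = {..<p * M} \<union> {p * M..<p * M + p}" by auto
  then have "(\<Sum>t<p * Suc M. f t) = (\<Sum>t<p * M. f t) + (\<Sum>t=p * M..<p * M + p. f t)"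
    by (simp add: sum.union_disjoint ivl_disj_int)
  also have "(\<Sum>t=p * M..<p * M + p. f t) = (\<Sum>y<p. f (y + p * M))"
    using sum.shift_bounds_nat_ivl[of f 0 "p * M" p] by (simp add: atLeast0LessThan add.commute)
  finally show ?case using Suc by (simp add: sum.distrib)
qed simp

text \<open>The cofactor of \<open>x - y\<close> in \<open>x^n - y^n\<close> is a sum of
  \<open>n\<close> products, each congruent to \<open>y^(n-1)\<close> modulo \<open>p\<close>. For
  \<open>n = \<bar>p\<bar>\<close> it is therefore divisible by \<open>p\<close>, which gives the
  additional factor.\<close>

lemma power_diff_dvd_lift:
  fixes x y :: int
  assumes "p ^ a dvd x - y" "a \<ge> 1"
  shows "p ^ (a + 1) dvd x ^ nat \<bar>p\<bar> - y ^ nat \<bar>p\<bar>"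
proof -
  let ?n = "nat \<bar>p\<bar>"
  have p: "p dvd x - y" using assms dvd_power_le[of p p 1 a] dvd_trans by fastforce
  have "p dvd (\<Sum>i<?n. y ^ (?n - Suc i) * x ^ i) - (\<Sum>i<?n. y ^ (?n - 1))"
    unfolding sum_subtractf[symmetric]
  proof (rule dvd_sum)
    fix i assume i: "i \<in> {..<?n}"
    have "y ^ (?n - 1) = y ^ (?n - Suc i) * y ^ i"
      using i by (simp add: power_add[symmetric])
    then have "y ^ (?n - Suc i) * x ^ i - y ^ (?n - 1) = y ^ (?n - Suc i) * (x ^ i - y ^ i)"
      by (simp add: algebra_simps)
    moreover have "x - y dvd x ^ i - y ^ i" by (simp add: power_diff_sumr2)
    ultimately show "p dvd y ^ (?n - Suc i) * x ^ i - y ^ (?n - 1)"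
      using p by (metis dvd_mult dvd_trans)
  qed
  from dvd_add[OF this, of "\<Sum>i<?n. y ^ (?n - 1)"]
  have "p dvd (\<Sum>i<?n. y ^ (?n - Suc i) * x ^ i)" by simp
  then have "p ^ a * p dvd (x - y) * (\<Sum>i<?n. y ^ (?n - Suc i) * x ^ i)"
    by (rule mult_dvd_mono[OF assms(1)])
  then show ?thesis by (simp add: power_diff_sumr2 mult.commute)
qed

text \<open>Lifting the exponent: \<open>v\<close> rounds of the previous lemma treat the exponent
  \<open>\<bar>p\<bar>^v\<close>, and the remaining cofactor of \<open>k\<close> preserves
  divisibility.\<close>

lemma power_diff_dvd:
  fixes x y :: int
  assumes "p ^ a dvd x - y" "a \<ge> 1" "p ^ v dvd int k"
  shows "p ^ (a + v) dvd x ^ k - y ^ k"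
proof -
  let ?n = "nat \<bar>p\<bar>"
  have "p ^ (a + v) dvd x ^ (?n ^ v) - y ^ (?n ^ v)"
  proof (induction v)
    case (Suc v)
    then show ?case
      using power_diff_dvd_lift[of p "a + v" "x ^ (?n ^ v)" "y ^ (?n ^ v)"] assms
      by (simp add: power_mult[symmetric] mult.commute)
  qed (use assms in simp)
  moreover have "?n ^ v dvd k"
  proof -
    have "int (?n ^ v) = \<bar>p ^ v\<bar>" by (simp add: power_abs)
    then show ?thesis using assms(3)
      by (metis abs_dvd_iff int_dvd_int_iff)
  qed
  then obtain u where "k = ?n ^ v * u" by blast
  then have "x ^ (?n ^ v) - y ^ (?n ^ v) dvd x ^ k - y ^ k"
    by (simp add: power_mult power_diff_sumr2[of "x ^ (?n ^ v)" u])
  ultimately show ?thesis using dvd_trans by blast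
qed

lemma diff_dvd_poly_diff: "x - y dvd poly P x - poly P y" for x y :: "'a::comm_ring_1"
proof -
  have "poly P x - poly P y = (\<Sum>i\<le>degree P. coeff P i * (x ^ i - y ^ i))"
    by (simp add: poly_altdef sum_subtractf right_diff_distrib)
  moreover have "x - y dvd x ^ i - y ^ i" for i by (simp add: power_diff_sumr2)
  ultimately show ?thesis by (auto intro!: dvd_sum dvd_mult)
qed

section \<open>Character sums modulo p^N and their vanishing\<close>

definition unity_char :: "nat \<Rightarrow> nat \<Rightarrow> int \<Rightarrow> complex" where
  "unity_char p N u = cis (2 * pi * (of_int u / of_nat p ^ N))"

lemma unity_char_add: "unity_char p N (u + v) = unity_char p N u * unity_char p N v"
  by (simp add: unity_char_def cis_mult add_divide_distrib distrib_left)

lemma norm_unity_char [simp]: "cmod (unity_char p N u) = 1"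
  by (simp add: unity_char_def)

lemma unity_char_eq_1_iff:
  assumes "p > 0"
  shows "unity_char p N u = 1 \<longleftrightarrow> int p ^ N dvd u"
proof
  assume "int p ^ N dvd u"
  then obtain v where "u = int p ^ N * v" by blast
  then show "unity_char p N u = 1" using assms by (simp add: unity_char_def)
next
  assume "unity_char p N u = 1"
  then have "cos (2 * pi * (of_int u / of_nat p ^ N)) = 1"
    by (simp add: unity_char_def complex_eq_iff)
  then obtain m :: int where "2 * pi * (of_int u / of_nat p ^ N) = m * 2 * pi"
    by (auto simp: cos_one_2pi_int)
  then have "real_of_int u = real_of_int m * real p ^ N"
    using assms by (simp add: field_simps)
  then have "u = m * int p ^ N" by (metis of_int_eq_iff of_int_mult of_int_of_nat_eq of_int_power)
  then show "int p ^ N dvd u" by simp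
qed

lemma unity_char_cong:
  assumes "p > 0" "int p ^ N dvd u - v"
  shows "unity_char p N u = unity_char p N v"
  using unity_char_add[of p N "u - v" v] unity_char_eq_1_iff[of p N "u - v"] assms by simp

definition expsum :: "nat \<Rightarrow> nat \<Rightarrow> nat \<Rightarrow> int poly \<Rightarrow> complex" where
  "expsum p N K P = (\<Sum>t<p ^ K. unity_char p N (poly P (int t)))"

text \<open>A splitting lowers \<open>K\<close> and leaves \<open>N\<close> alone, so
  \<open>N \<le> K\<close> is lost along the recursion. Periodicity of the summand with period
  \<open>p^K\<close> is the invariant that survives, and it is all that the shift argument
  uses.\<close>

definition periodic_mod :: "nat \<Rightarrow> nat \<Rightarrow> nat \<Rightarrow> int poly \<Rightarrow> bool" where
  "periodic_mod p N K P \<longleftrightarrow> (\<forall>t. int p ^ N dvd poly P (t + int p ^ K) - poly P t)"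

lemma norm_expsum_le: "cmod (expsum p N K P) \<le> real p ^ K"
proof -
  have "cmod (expsum p N K P) \<le> (\<Sum>t<p ^ K. 1)"
    unfolding expsum_def by (rule order_trans[OF norm_sum]) simp
  then show ?thesis by simp
qed

lemma periodic_mod_pcompose:
  assumes "periodic_mod p N (Suc K) P"
  shows "periodic_mod p N K (P \<circ>\<^sub>p [:y, int p:])"
proof -
  have "poly (P \<circ>\<^sub>p [:y, int p:]) (t + int p ^ K) = poly P ((y + int p * t) + int p ^ Suc K)" for t
    by (simp add: poly_pcompose algebra_simps)
  then show ?thesis using assms by (simp add: periodic_mod_def) (simp add: poly_pcompose mult.commute)
qed

lemma expsum_Suc:
  "expsum p N (Suc K) P = (\<Sum>y<p. expsum p N K (P \<circ>\<^sub>p [:int y, int p:]))"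
  unfolding expsum_def power_Suc sum_lessThan_mult_nat
  by (simp add: poly_pcompose mult.commute)

lemma expsum_eq_0:
  assumes p: "prime p"
    and hi: "\<And>k. k \<ge> 1 \<Longrightarrow> int p ^ (w + 1) dvd coeff (pderiv P) k"
    and lo: "\<not> int p ^ (w + 1) dvd coeff (pderiv P) 0"
    and N: "w + 2 \<le> N"
    and per: "periodic_mod p N K P"
  shows "expsum p N K P = 0"
proof -
  have p0: "p > 0" using p prime_gt_0_nat by blast
  define h where "h = p ^ (N - w - 1)"
  have step: "int p ^ N dvd poly P (t + int h) - (poly P t + coeff P 1 * int h)" for t
  proof -
    \<comment> \<open>The hypothesis controls only \<open>k * coeff P k\<close>. If
      \<open>p^v\<close> divides \<open>k\<close>, the coefficient may lack \<open>v\<close> factors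
      \<open>p\<close>, but \<open>(t + h)^k - t^k\<close> has \<open>v\<close> more than
      \<open>h\<close>. Since \<open>N \<ge> w + 2\<close>, \<open>h\<close> is divisible by
      \<open>p\<close>, as lifting the exponent requires.\<close>
    have trm: "int p ^ N dvd coeff P k * ((t + int h) ^ k - t ^ k)" if "k \<noteq> 1" for k
    proof (cases "k = 0")
      case False
      then have "int p ^ (w + 1) dvd coeff (pderiv P) (k - 1)" using that by (intro hi) auto
      then have kc: "int p ^ (w + 1) dvd int k * coeff P k"
        using False by (simp add: coeff_pderiv)
      define v where "v = multiplicity (int p) (int k)"
      have pv: "int p ^ v dvd int k" by (simp add: v_def multiplicity_dvd)
      then have d: "int p ^ (N - w - 1 + v) dvd (t + int h) ^ k - t ^ k"
        using N by (intro power_diff_dvd) (auto simp: h_def)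
      show ?thesis
      proof (cases "v \<ge> w + 1")
        case True
        then have "int p ^ N dvd int p ^ (N - w - 1 + v)" using N by (intro le_imp_power_dvd) auto
        then show ?thesis using d by (meson dvd_mult dvd_trans)
      next
        case vw: False
        obtain u where u: "int k = int p ^ v * u" using pv by blast
        have "\<not> int p dvd u"
          using multiplicity_decompose[of "int k" "int p"] u False p0 p
          unfolding v_def
          by (metis mult_left_cancel not_prime_unit of_nat_0_eq_iff power_eq_0_iff prime_nat_int_transfer
               multiplicity_decompose' less_numeral_extra(3))
        have "int p ^ v * int p ^ (w + 1 - v) dvd int p ^ v * (u * coeff P k)"
          using kc vw unfolding u by (simp add: power_add[symmetric] mult.assoc del: power_Suc)
        then have "int p ^ (w + 1 - v) dvd u * coeff P k" using p0 by simp
        moreover have "coprime (int p ^ (w + 1 - v)) u"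
          using \<open>\<not> int p dvd u\<close> p by (simp add: prime_imp_coprime)
        ultimately have "int p ^ (w + 1 - v) dvd coeff P k"
          by (simp add: coprime_dvd_mult_right_iff)
        then have "int p ^ (w + 1 - v) * int p ^ (N - w - 1 + v) dvd coeff P k * ((t + int h) ^ k - t ^ k)"
          using d by (rule mult_dvd_mono)
        then show ?thesis using vw N by (simp add: power_add[symmetric])
      qed
    qed simp
    have "degree P \<noteq> 0"
    proof
      assume "degree P = 0"
      then have "pderiv P = 0" by (simp add: pderiv_eq_0_iff)
      then show False using lo by simp
    qed
    then have 1: "1 \<in> {..degree P}" by auto
    have "poly P (t + int h) - poly P t = (\<Sum>k\<le>degree P. coeff P k * ((t + int h) ^ k - t ^ k))"
      by (simp add: poly_altdef sum_subtractf right_diff_distrib)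
    also have "\<dots> = coeff P 1 * int h + (\<Sum>k\<in>{..degree P} - {1}. coeff P k * ((t + int h) ^ k - t ^ k))"
      using sum.remove[OF _ 1, of "\<lambda>k. coeff P k * ((t + int h) ^ k - t ^ k)"] by simp
    finally have "poly P (t + int h) - (poly P t + coeff P 1 * int h)
        = (\<Sum>k\<in>{..degree P} - {1}. coeff P k * ((t + int h) ^ k - t ^ k))" by simp
    then show ?thesis using trm by (auto intro: dvd_sum)
  qed
  define z where "z = unity_char p N (coeff P 1 * int h)"
  have "z \<noteq> 1"
  proof
    assume "z = 1"
    then have "int p ^ N dvd coeff P 1 * int h" using unity_char_eq_1_iff[OF p0] z_def by simp
    moreover have "int p ^ N = int p ^ (w + 1) * int h"
      using N by (simp add: h_def power_add[symmetric] del: power_Suc)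
    ultimately have "int p ^ (w + 1) dvd coeff P 1" using p0 by (simp add: h_def)
    then show False using lo by (simp add: coeff_pderiv)
  qed
  let ?f = "\<lambda>t. unity_char p N (poly P (int t))"
  have "?f (t + p ^ K) = ?f t" for t
    using per p0 by (intro unity_char_cong) (simp_all add: periodic_mod_def)
  then have "expsum p N K P = (\<Sum>t<p ^ K. ?f (t + h))"
    unfolding expsum_def by (rule sum_lessThan_shift_periodic[symmetric])
  also have "\<dots> = (\<Sum>t<p ^ K. ?f t * z)"
    unfolding z_def unity_char_add[symmetric]
    by (intro sum.cong refl unity_char_cong) (use p0 step in auto)
  also have "\<dots> = expsum p N K P * z" by (simp add: expsum_def sum_distrib_right)
  finally show ?thesis using \<open>z \<noteq> 1\<close> by simp
qed

section \<open>Weierstrass degree under affine substitutions\<close>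

text \<open>The Weierstrass degree of \<open>g\<close>: \<open>m\<close> is the degree modulo \<open>p\<close> of \<open>g / p ^ w\<close>,
  where \<open>w\<close> is the least \<open>p\<close>-adic valuation of a coefficient.\<close>
definition wdeg :: "nat \<Rightarrow> int poly \<Rightarrow> nat \<Rightarrow> nat \<Rightarrow> bool" where
  "wdeg p g m w \<longleftrightarrow> (\<forall>k. int p ^ w dvd coeff g k) \<and> \<not> int p ^ (w + 1) dvd coeff g m \<and>
     (\<forall>k>m. int p ^ (w + 1) dvd coeff g k)"

text \<open>Both numbers are maxima over bounded sets: \<open>p^w\<close> is at most the absolute
  value of the leading coefficient, and \<open>m\<close> at most the degree.\<close>

lemma wdeg_exists:
  assumes "p > 1" "g \<noteq> 0"
  obtains m w where "wdeg p g m w"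
proof -
  let ?Q = "\<lambda>w. \<forall>k. int p ^ w dvd coeff g k"
  have bd: "w \<le> nat \<bar>lead_coeff g\<bar>" if "?Q w" for w
  proof -
    have "int p ^ w dvd lead_coeff g" using that by blast
    then have "int p ^ w \<le> \<bar>lead_coeff g\<bar>"
      using dvd_imp_le_int[of "lead_coeff g" "int p ^ w"] assms by simp
    moreover have "w < p ^ w" using assms(1) power_gt_expt by simp
    ultimately show ?thesis by (simp add: le_nat_iff) (metis less_imp_le of_nat_le_iff of_nat_power order_trans)
  qed
  define w where "w = Greatest ?Q"
  have w: "?Q w" unfolding w_def by (rule GreatestI_nat[of ?Q 0]) (use bd in auto)
  have "\<not> ?Q (w + 1)"
    using Greatest_le_nat[of ?Q "w + 1" "nat \<bar>lead_coeff g\<bar>"] bd w_def by auto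
  then obtain k0 where k0: "\<not> int p ^ (w + 1) dvd coeff g k0" by blast
  let ?R = "\<lambda>k. \<not> int p ^ (w + 1) dvd coeff g k"
  have bd': "k \<le> degree g" if "?R k" for k using that by (intro le_degree) auto
  define m where "m = Greatest ?R"
  have "?R m" unfolding m_def by (rule GreatestI_nat[of ?R k0]) (use bd' k0 in auto)
  moreover have "int p ^ (w + 1) dvd coeff g k" if "k > m" for k
    using Greatest_le_nat[of ?R k "degree g"] bd' that m_def by force
  ultimately show ?thesis using that w unfolding wdeg_def by blast
qed

text \<open>Accounts for the factor \<open>p\<close> that the chain rule puts before the derivative
  of \<open>P(y + p t)\<close>.\<close>

lemma wdeg_smult:
  assumes "p > 0"
  shows "wdeg p (smult (int p) g) m (Suc w) \<longleftrightarrow> wdeg p g m w"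
  using assms by (simp add: wdeg_def)

text \<open>Modulo \<open>p^(w+1)\<close> only the truncation \<open>A\<close> at index
  \<open>m\<close> matters, and a translation keeps the degree and the leading coefficient of
  \<open>A\<close>.\<close>

lemma wdeg_shift:
  assumes "wdeg p g m w"
  shows "wdeg p (g \<circ>\<^sub>p [:y, 1:]) m w"
proof -
  define A where "A = poly_cutoff (Suc m) g"
  let ?s = "[:y, 1::int:]"
  let ?A = "A \<circ>\<^sub>p ?s"
  have coA: "coeff A k = (if k \<le> m then coeff g k else 0)" for k
    by (simp add: A_def coeff_poly_cutoff)
  have cm: "coeff g m \<noteq> 0" using assms by (auto simp: wdeg_def)
  then have dA: "degree A = m" by (intro antisym degree_le le_degree) (auto simp: coA)
  then have dA': "degree ?A = m" "lead_coeff ?A = coeff g m"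
    by (simp add: degree_pcompose) (subst lead_coeff_comp, auto simp: dA coA)
  have "[:int p ^ w:] dvd g" using assms by (simp add: const_poly_dvd_iff wdeg_def)
  then have 1: "[:int p ^ w:] dvd g \<circ>\<^sub>p ?s"
    by (metis dvdE dvdI pcompose_const pcompose_mult)
  have "[:int p ^ (w + 1):] dvd g - A"
    using assms by (auto simp: const_poly_dvd_iff wdeg_def coA not_le)
  then have "[:int p ^ (w + 1):] dvd (g - A) \<circ>\<^sub>p ?s"
    by (metis dvdE dvdI pcompose_const pcompose_mult)
  then have "int p ^ (w + 1) dvd coeff (g \<circ>\<^sub>p ?s) k - coeff ?A k" for k
    by (simp only: pcompose_diff const_poly_dvd_iff coeff_diff)
  then have 2: "int p ^ (w + 1) dvd coeff (g \<circ>\<^sub>p ?s) k \<longleftrightarrow> int p ^ (w + 1) dvd coeff ?A k" for k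
    using dvd_add dvd_diff by (metis add_diff_cancel_left' diff_add_cancel)
  have 3: "int p ^ w dvd coeff (g \<circ>\<^sub>p ?s) k" for k
    using 1 by (simp add: const_poly_dvd_iff)
  have 4: "\<not> int p ^ (w + 1) dvd coeff ?A m" using assms dA' by (simp add: wdeg_def)
  have 5: "int p ^ (w + 1) dvd coeff ?A k" if "k > m" for k using that dA' by (simp add: coeff_eq_0)
  show ?thesis unfolding wdeg_def 2 using 3 4 5 by blast
qed

text \<open>Substituting \<open>p x\<close> multiplies coefficient \<open>k\<close> by
  \<open>p^k\<close>, which favours low indices: a coefficient beyond \<open>m\<close>, already of
  larger valuation, falls further behind the one at \<open>m\<close>.\<close>

lemma wdeg_scale_le:
  assumes "p > 0" "wdeg p g m w" "wdeg p (g \<circ>\<^sub>p [:0, int p:]) m' w'"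
  shows "m' \<le> m"
proof (rule ccontr)
  assume "\<not> m' \<le> m"
  then have m: "m < m'" by simp
  have "int p ^ w' dvd int p ^ m * coeff g m"
    using assms(3) by (simp add: wdeg_def coeff_pcompose_linear)
  have "w' < w + m + 1"
  proof (rule ccontr)
    assume "\<not> ?thesis"
    then have "int p ^ m * int p ^ (w + 1) dvd int p ^ w'"
      unfolding power_add[symmetric] by (intro le_imp_power_dvd) auto
    then have "int p ^ m * int p ^ (w + 1) dvd int p ^ m * coeff g m"
      using \<open>int p ^ w' dvd _\<close> dvd_trans by blast
    then show False using assms by (simp add: wdeg_def)
  qed
  have "int p ^ (w' + 1) dvd int p ^ (m' + (w + 1))"
    using \<open>w' < w + m + 1\<close> m by (intro le_imp_power_dvd) auto
  also have "\<dots> dvd int p ^ m' * coeff g m'"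
    unfolding power_add[of _ m'] using assms m by (intro mult_dvd_mono) (auto simp: wdeg_def)
  finally show False using assms(3) by (simp add: wdeg_def coeff_pcompose_linear)
qed

text \<open>In the equality case the least valuation after scaling is that of
  \<open>p^m * coeff g m\<close>, namely \<open>w + m\<close>. For \<open>k < m\<close> the factor
  \<open>p^k\<close> supplies only \<open>k\<close> of these, so \<open>coeff g k\<close> must
  supply at least \<open>w + 1\<close>. Thus \<open>g / p^w\<close> is a monomial modulo
  \<open>p\<close>.\<close>

lemma wdeg_scale_eq:
  assumes "p > 0" "wdeg p g m w" "wdeg p (g \<circ>\<^sub>p [:0, int p:]) m w'" "k \<noteq> m"
  shows "int p ^ (w + 1) dvd coeff g k"
proof (cases "k < m")
  case False then show ?thesis using assms by (auto simp: wdeg_def)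
next
  case True
  have "w' \<ge> w + m"
  proof (rule ccontr)
    assume "\<not> ?thesis"
    then have "int p ^ (w' + 1) dvd int p ^ (m + w)"
      by (intro le_imp_power_dvd) auto
    also have "\<dots> dvd int p ^ m * coeff g m"
      unfolding power_add using assms(2) by (intro mult_dvd_mono) (auto simp: wdeg_def)
    finally show False using assms(3) by (simp add: wdeg_def coeff_pcompose_linear)
  qed
  then have "int p ^ (k + (w + 1)) dvd int p ^ w'" using True by (intro le_imp_power_dvd) auto
  also have "\<dots> dvd int p ^ k * coeff g k"
    using assms(3) by (simp add: wdeg_def coeff_pcompose_linear)
  finally show ?thesis using assms(1) unfolding power_add[of _ k] by (subst (asm) dvd_times_left_cancel_iff) auto
qed

text \<open>By the equality case \<open>g(u)\<close> is congruent to \<open>coeff g m * u^m\<close>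
  modulo \<open>p^(w+1)\<close>, hence nonzero there because \<open>u\<close> is prime to
  \<open>p\<close>; every higher coefficient of \<open>g(u + p x)\<close> gains a factor
  \<open>p\<close>.\<close>

lemma wdeg_other_child:
  assumes p: "prime p" and g: "wdeg p g m w" "wdeg p (g \<circ>\<^sub>p [:0, int p:]) m w'"
    and u: "\<not> int p dvd u"
  shows "wdeg p (g \<circ>\<^sub>p [:u, int p:]) 0 w"
proof -
  have p0: "p > 0" using p prime_gt_0_nat by blast
  have eq: "g \<circ>\<^sub>p [:u, int p:] = (g \<circ>\<^sub>p [:u, 1:]) \<circ>\<^sub>p [:0, int p:]"
    by (simp add: pcompose_assoc[symmetric] pcompose_pCons)
  have all: "int p ^ w dvd coeff (g \<circ>\<^sub>p [:u, 1:]) k" for k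
    using wdeg_shift[OF g(1)] by (simp add: wdeg_def)
  have "\<not> int p ^ (w + 1) dvd poly g u"
  proof
    assume d: "int p ^ (w + 1) dvd poly g u"
    have m: "m \<in> {..degree g}"
      using g(1) by (auto simp: wdeg_def intro!: le_degree)
    have "poly g u = coeff g m * u ^ m + (\<Sum>k\<in>{..degree g} - {m}. coeff g k * u ^ k)"
      unfolding poly_altdef using sum.remove[OF _ m] by simp
    moreover have "int p ^ (w + 1) dvd (\<Sum>k\<in>{..degree g} - {m}. coeff g k * u ^ k)"
      using wdeg_scale_eq[OF p0 g] by (intro dvd_sum dvd_mult2) auto
    ultimately have "int p ^ (w + 1) dvd coeff g m * u ^ m"
      using d by (metis dvd_add_left_iff)
    moreover have "coprime (int p ^ (w + 1)) (u ^ m)"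
      using u p prime_imp_coprime[of "int p" u] by simp
    ultimately have "int p ^ (w + 1) dvd coeff g m" by (simp add: coprime_dvd_mult_left_iff)
    then show False using g by (simp add: wdeg_def)
  qed
  moreover have "coeff (g \<circ>\<^sub>p [:u, int p:]) 0 = poly g u"
    by (metis poly_0_coeff_0 poly_pcompose poly_pCons mult_zero_left add.right_neutral)
  moreover have "int p ^ (w + 1) dvd coeff (g \<circ>\<^sub>p [:u, int p:]) k" if "k > 0" for k
  proof -
    have "int p ^ (w + 1) dvd int p ^ (k + w)" using that by (intro le_imp_power_dvd) auto
    also have "\<dots> dvd coeff (g \<circ>\<^sub>p [:u, int p:]) k"
      unfolding eq coeff_pcompose_linear power_add using all by (intro mult_dvd_mono) auto
    finally show ?thesis .
  qed
  moreover have "int p ^ w dvd coeff (g \<circ>\<^sub>p [:u, int p:]) k" for k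
    unfolding eq coeff_pcompose_linear using all by simp
  ultimately show ?thesis by (simp add: wdeg_def)
qed

text \<open>\<open>L\<close> bounds the valuation of \<open>n * lead_coeff P\<close>. A splitting
  replaces \<open>K\<close> by \<open>K - 1\<close> and \<open>L\<close> by \<open>L + n\<close>, so
  \<open>L + s * n + 2 \<le> N\<close> keeps the vanishing criterion available through all
  \<open>s\<close> generations. The exponent \<open>m - 1\<close> is a budget from which branchings
  are paid.\<close>

lemma expsum_wdeg_bound:
  assumes p: "prime p"
  shows "wdeg p (pderiv P) m w \<Longrightarrow> degree P = n \<Longrightarrow> n \<ge> 1 \<Longrightarrow>
     \<not> int p ^ (L + 1) dvd int n * lead_coeff P \<Longrightarrow> L + s * n + 2 \<le> N \<Longrightarrow> s \<le> K \<Longrightarrow>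
     periodic_mod p N K P \<Longrightarrow>
     cmod (expsum p N K P) \<le> (if m = 0 then 0 else real p ^ (K - s) * real p ^ (m - 1))"
proof (induction s arbitrary: P m w L K)
  have p1: "p > 1" and p0: "p > 0" using p prime_gt_1_nat[OF p] by auto
  have vanish: "expsum p N K P = 0"
    if "wdeg p (pderiv P) 0 w" "degree P = n" "n \<ge> 1"
      "\<not> int p ^ (L + 1) dvd int n * lead_coeff P" "L + 2 \<le> N" "periodic_mod p N K P" for P w L K
  proof (rule expsum_eq_0[OF p])
    \<comment> \<open>The coefficient of \<open>P'\<close> at \<open>n - 1\<close> is
      \<open>n * lead_coeff P\<close>, whence \<open>w \<le> L\<close>.\<close>
    have "int p ^ w dvd coeff (pderiv P) (n - 1)" using that(1) by (simp add: wdeg_def)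
    then have "int p ^ w dvd int n * lead_coeff P" using that(2,3) by (simp add: coeff_pderiv)
    then have "w < L + 1" using that(4) by (meson dvd_trans le_imp_power_dvd not_le)
    then show "w + 2 \<le> N" using that(5) by simp
  qed (use that in \<open>auto simp: wdeg_def\<close>)
  {
    case 0
    then show ?case
      using vanish norm_expsum_le[of p N K P] mult_mono[of "real p ^ K" "real p ^ K" 1 "real p ^ (m - 1)"] p1
      by (cases "m = 0") (auto intro: order_trans)
  next
    case (Suc s)
    show ?case
    proof (cases "m = 0")
      case True
      then show ?thesis using vanish[of P w L K] Suc.prems by simp
    next
      case m: False
      obtain K' where K: "K = Suc K'" using Suc.prems(6) by (cases K) auto
      let ?P = "\<lambda>y. P \<circ>\<^sub>p [:int y, int p:]"
      let ?g = "\<lambda>y. pderiv P \<circ>\<^sub>p [:int y, int p:]"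
      have pd: "pderiv (?P y) = smult (int p) (?g y)" for y
        by (simp add: pderiv_pcompose pderiv_pCons)
      have dP: "degree (?P y) = n" for y using Suc.prems p0 by (simp add: degree_pcompose)
      have lc: "int n * lead_coeff (?P y) = int p ^ n * (int n * lead_coeff P)" for y
        using Suc.prems p0 by (subst lead_coeff_comp) (auto simp: mult_ac)
      have lcd: "\<not> int p ^ (L + n + 1) dvd int n * lead_coeff (?P y)" for y
      proof
        assume "int p ^ (L + n + 1) dvd int n * lead_coeff (?P y)"
        then have "int p ^ n * int p ^ (L + 1) dvd int p ^ n * (int n * lead_coeff P)"
          unfolding lc by (simp add: power_add mult_ac)
        then show False using Suc.prems(4) p0 by simp
      qed
      have per: "periodic_mod p N K' (?P y)" for y
        using Suc.prems K by (intro periodic_mod_pcompose) simp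
      \<comment> \<open>The derivative of the child is \<open>p\<close> times \<open>?g y\<close>:
        its valuation index is \<open>Suc w'\<close>, with the same \<open>m'\<close>.\<close>
      have IH: "cmod (expsum p N K' (?P y)) \<le> (if m' = 0 then 0 else real p ^ (K' - s) * real p ^ (m' - 1))"
        if "wdeg p (?g y) m' w'" for y m' w'
        using Suc.IH[of "?P y" m' "Suc w'" "L + n" K'] that lcd[of y] per[of y] dP[of y] Suc.prems p0 K
        by (simp add: pd wdeg_smult add.assoc)
      have shift: "?g y = (pderiv P \<circ>\<^sub>p [:int y, 1:]) \<circ>\<^sub>p [:0, int p:]" for y
        by (simp add: pcompose_assoc[symmetric] pcompose_pCons)
      have g0: "?g y \<noteq> 0" for y
      proof
        assume "?g y = 0"
        then have "degree (?P y) = 0" using pd[of y] by (simp add: pderiv_eq_0_iff)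
        then show False using dP Suc.prems by simp
      qed
      have tri: "cmod (expsum p N K P) \<le> (\<Sum>y<p. cmod (expsum p N K' (?P y)))"
        unfolding K expsum_Suc by (rule norm_sum)
      show ?thesis
      proof (cases "\<exists>y<p. \<exists>w'. wdeg p (?g y) m w'")
        case True
        then obtain y w' where y: "y < p" "wdeg p (?g y) m w'" by blast
        have "cmod (expsum p N K' (?P z)) = 0" if z: "z < p" "z \<noteq> y" for z
        proof -
          have nd: "\<not> int p dvd int z - int y"
          proof
            assume "int p dvd int z - int y"
            then have "\<bar>int z - int y\<bar> \<ge> int p" using z by (intro dvd_imp_le_int[of _ "int p", simplified]) auto
            then show False using z y by linarith
          qed
          \<comment> \<open>Seen from the centre \<open>y\<close> that keeps \<open>m\<close>, the
            child at \<open>z\<close> is the one with offset \<open>z - y\<close>, which is prime to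
            \<open>p\<close>.\<close>
          have "wdeg p ((pderiv P \<circ>\<^sub>p [:int y, 1:]) \<circ>\<^sub>p [:int z - int y, int p:]) 0 w"
            by (rule wdeg_other_child[OF p wdeg_shift[OF Suc.prems(1)] _ nd]) (use y shift in simp)
          then have "wdeg p (?g z) 0 w" by (simp add: pcompose_assoc[symmetric] pcompose_pCons)
          then show ?thesis using IH[of z 0 w] by simp
        qed
        then have "(\<Sum>z<p. cmod (expsum p N K' (?P z))) = cmod (expsum p N K' (?P y))"
          using y by (subst sum.remove[of _ y]) auto
        then show ?thesis using tri IH[OF y(2)] m K by simp
      next
        case False
        \<comment> \<open>If no child keeps \<open>m\<close>, all \<open>p\<close> of them may
          survive, and the drop from exponent \<open>m - 1\<close> to \<open>m - 2\<close> pays for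
          their number. For \<open>m = 1\<close> every child has degree 0 and vanishes.\<close>
        have "cmod (expsum p N K' (?P y)) \<le> (if m = 1 then 0 else real p ^ (K' - s) * real p ^ (m - 2))"
          if y: "y < p" for y
        proof -
          obtain m' w' where w': "wdeg p (?g y) m' w'" using wdeg_exists[OF p1 g0] by blast
          have "m' \<le> m"
            using wdeg_scale_le[OF p0 wdeg_shift[OF Suc.prems(1), of "int y"]] w' shift by metis
          moreover have "m' \<noteq> m" using False y w' by blast
          ultimately have lt: "m' < m" by simp
          show ?thesis
          proof (cases "m' = 0")
            case True
            then show ?thesis using IH[OF w'] by simp
          next
            case False
            then have "real p ^ (m' - 1) \<le> real p ^ (m - 2)" using lt p1 by (intro power_increasing) auto
            then have "real p ^ (K' - s) * real p ^ (m' - 1) \<le> real p ^ (K' - s) * real p ^ (m - 2)"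
              by (intro mult_left_mono) auto
            then show ?thesis using IH[OF w'] False lt by simp
          qed
        qed
        then have "(\<Sum>y<p. cmod (expsum p N K' (?P y)))
            \<le> (\<Sum>y<p. if m = 1 then 0 else real p ^ (K' - s) * real p ^ (m - 2))"
          by (intro sum_mono) auto
        also have "\<dots> \<le> real p ^ (K' - s) * real p ^ (m - 1)"
        proof (cases "m = 1")
          case False
          then have "m - 1 = Suc (m - 2)" using m by simp
          then show ?thesis by (simp add: False mult_ac)
        qed simp
        finally show ?thesis using tri m K by simp
      qed
    qed
  }
qed

theorem expsum_bound:
  assumes p: "prime p" and P: "degree P = n" "n \<ge> 1"
    and N: "N \<le> K"
  shows "cmod (expsum p N K P) \<le>
     real p ^ K * real p ^ n * real p powr ((real (multiplicity (int p) (lead_coeff P)) - real N) / real n)"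
proof -
  have p1: "p > 1" and p0: "p > 0" using p prime_gt_1_nat[OF p] by auto
  define v where "v = multiplicity (int p) (lead_coeff P)"
  define L where "L = multiplicity (int p) (int n * lead_coeff P)"
  have lc: "lead_coeff P \<noteq> 0" using P by auto
  have nz: "int n * lead_coeff P \<noteq> 0" using lc P by simp
  have L: "\<not> int p ^ (L + 1) dvd int n * lead_coeff P"
    using power_dvd_iff_le_multiplicity[of "int n * lead_coeff P" "int p" "L + 1"] nz p p1
    by (simp add: L_def)
  have Lv: "L = multiplicity (int p) (int n) + v"
    unfolding L_def v_def using P lc p by (intro prime_elem_multiplicity_mult_distrib) auto
  \<comment> \<open>The loss when \<open>p\<close> divides \<open>n\<close> is limited by
    \<open>p^v \<le> n \<le> p^(n-1)\<close>, where \<open>v\<close> is here the valuation of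
    \<open>n\<close>.\<close>
  have "real p ^ multiplicity (int p) (int n) \<le> real n"
  proof -
    have "int p ^ multiplicity (int p) (int n) dvd int n" by (rule multiplicity_dvd)
    then have "int p ^ multiplicity (int p) (int n) \<le> int n"
      using P by (intro zdvd_imp_le) auto
    then show ?thesis by (metis of_int_le_iff of_int_of_nat_eq of_int_power)
  qed
  moreover have "n \<le> p ^ (n - 1)"
    using power_gt_expt[of p "n - 1"] p1 P by simp
  then have "real n \<le> real p ^ (n - 1)" by (metis of_nat_le_iff of_nat_power)
  ultimately have "real p ^ multiplicity (int p) (int n) \<le> real p ^ (n - 1)" by linarith
  then have mn: "multiplicity (int p) (int n) \<le> n - 1" using p1 by simp
  have per: "periodic_mod p N K P"
    unfolding periodic_mod_def
  proof
    fix t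
    have "int p ^ K dvd poly P (t + int p ^ K) - poly P t"
      using diff_dvd_poly_diff[of "t + int p ^ K" t P] by simp
    then show "int p ^ N dvd poly P (t + int p ^ K) - poly P t"
      using N by (meson dvd_trans le_imp_power_dvd)
  qed
  have npow: "real p ^ k = real p powr real k" for k using p0 by (simp add: powr_realpow)
  show ?thesis
  proof (cases "L + 2 \<le> N")
    case False
    \<comment> \<open>For such small \<open>N\<close> the vanishing criterion is out of reach, but
      then the claimed bound is at least the trivial \<open>p^K\<close>.\<close>
    then have "real N \<le> real v + real n" using Lv mn P by simp
    then have "- 1 \<le> (real v - real N) / real n" using P by (simp add: field_simps)
    then have "0 \<le> real n + (real v - real N) / real n" using P by linarith
    then have "real p powr 0 \<le> real p powr (real n + (real v - real N) / real n)"
      using p1 by (intro powr_mono) auto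
    then have "1 \<le> real p ^ n * real p powr ((real v - real N) / real n)"
      using p0 by (simp add: npow powr_add)
    then have "real p ^ K * 1 \<le> real p ^ K * (real p ^ n * real p powr ((real v - real N) / real n))"
      by (intro mult_left_mono) auto
    then show ?thesis using norm_expsum_le[of p N K P] by (simp add: v_def mult.assoc)
  next
    case True
    define s where "s = (N - L - 2) div n"
    have s: "s * n \<le> N - L - 2" "N - L - 2 < s * n + n"
      using P div_times_less_eq_dividend[of "N - L - 2" n] dividend_less_div_times[of n "N - L - 2"]
      by (auto simp: s_def add.commute)
    have sK: "s \<le> K"
    proof -
      have "s * 1 \<le> s * n" using P by (intro mult_le_mono) auto
      then show ?thesis using s N by linarith
    qed
    have "pderiv P \<noteq> 0" using P by (simp add: pderiv_eq_0_iff)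
    then obtain m w where mw: "wdeg p (pderiv P) m w" using wdeg_exists[OF p1] by blast
    have "coeff (pderiv P) m \<noteq> 0" using mw by (auto simp: wdeg_def)
    then have "m \<le> n - 1" using le_degree[of "pderiv P" m] P by (simp add: degree_pderiv)
    have "cmod (expsum p N K P) \<le> (if m = 0 then 0 else real p ^ (K - s) * real p ^ (m - 1))"
      using True s by (intro expsum_wdeg_bound[OF p mw P L _ sK per]) simp
    \<comment> \<open>A real exponent, since \<open>n - 2\<close> is negative for
      \<open>n = 1\<close>; in that case \<open>m = 0\<close> and the left side is zero.\<close>
    also have "\<dots> \<le> real p ^ (K - s) * real p powr (real n - 2)"
      using \<open>m \<le> n - 1\<close> p1 by (auto simp: npow intro!: mult_left_mono powr_mono)
    also have "\<dots> = real p powr (real K - real s + real n - 2)"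
      using sK p0 by (simp add: npow powr_add[symmetric] of_nat_diff add_diff_eq)
    also have "\<dots> \<le> real p powr (real K + real n + (real v - real N) / real n)"
    proof (intro powr_mono)
      \<comment> \<open>The excess \<open>2 * n\<close> consists of the threshold \<open>2\<close>,
        at most \<open>n - 1\<close> from rounding \<open>s\<close> down, and at most
        \<open>n - 1\<close> from the valuation of \<open>n\<close>. Divided by \<open>n\<close> it
        becomes the \<open>2\<close> that raises \<open>n - 2\<close> to \<open>n\<close>.\<close>
      have "N \<le> v + s * n + 2 * n" using s True Lv mn P(2) by linarith
      then have "real N \<le> real (v + s * n + 2 * n)" by (simp only: of_nat_le_iff)
      then have "real N - real v \<le> real s * real n + 2 * real n" by simp
      then have "(real N - real v) / real n \<le> real s + 2" using P by (simp add: field_simps)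
      moreover have "(real v - real N) / real n = - ((real N - real v) / real n)"
        by (simp add: diff_divide_distrib)
      ultimately show "real K - real s + real n - 2 \<le> real K + real n + (real v - real N) / real n"
        by linarith
    qed (use p1 in auto)
    also have "\<dots> = real p ^ K * real p ^ n * real p powr ((real v - real N) / real n)"
      using p0 by (simp add: npow powr_add)
    finally show ?thesis by (simp add: v_def)
  qed
qed

section \<open>The p-adic absolute value on the rationals\<close>

text \<open>Stated for any \<open>floor_ceiling\<close> type because it serves twice: for digits of
  rationals in the standard expansion and for digits of reals in the Monna map.\<close>

lemma floor_divide_of_nat_eq_div:
  fixes x :: "'a::floor_ceiling"
  assumes "n > 0"
  shows "\<lfloor>x / of_nat n\<rfloor> = \<lfloor>x\<rfloor> div int n"
proof (rule floor_unique)
  let ?q = "\<lfloor>x\<rfloor> div int n"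
  have "?q * int n \<le> \<lfloor>x\<rfloor>" using assms pos_mod_sign[of "int n" "\<lfloor>x\<rfloor>"] by (simp add: minus_mod_eq_div_mult[symmetric])
  then have "of_int (?q * int n) \<le> x" by (simp only: le_floor_iff)
  then show "of_int ?q \<le> x / of_nat n" using assms by (simp add: pos_le_divide_eq)
  have "\<lfloor>x\<rfloor> mod int n < int n" using assms by simp
  then have "\<lfloor>x\<rfloor> + 1 \<le> (?q + 1) * int n"
    unfolding distrib_right minus_mod_eq_div_mult[symmetric] by linarith
  then have "\<lfloor>x\<rfloor> < (?q + 1) * int n" by linarith
  then have "x < of_int ((?q + 1) * int n)" by (simp only: floor_less_iff)
  then show "x / of_nat n < of_int ?q + 1" using assms by (simp add: pos_divide_less_eq)
qed

locale padic =
  fixes p :: nat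
  assumes prime: "prime p"
begin

abbreviation "pw s \<equiv> real p powi s"
abbreviation "rp s \<equiv> (of_nat p :: rat) powi s"
abbreviation "av q \<equiv> pabs_rat p q"

lemma p_gt_1: "p > 1" and p_gt_0: "p > 0" and p_ge_2: "p \<ge> 2"
  using prime_gt_1_nat[OF prime] by auto

lemma pw_pos [simp]: "pw s > 0" and pw_nonneg [simp]: "pw s \<ge> 0" and pw_neq_0 [simp]: "pw s \<noteq> 0"
  and rp_pos [simp]: "rp s > 0" and rp_neq_0 [simp]: "rp s \<noteq> 0"
  using p_gt_0 by (auto simp: zero_less_power_int less_imp_le)

lemma pw_le_iff [simp]: "pw s \<le> pw t \<longleftrightarrow> s \<le> t"
  using power_int_strict_increasing[of t s "real p"] power_int_increasing[of s t "real p"] p_gt_1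
  by (cases "s \<le> t") auto

lemma pw_add: "pw (s + t) = pw s * pw t" and rp_add: "rp (s + t) = rp s * rp t"
  using p_gt_0 by (auto simp: power_int_add)

lemma ex_pw_less: "e > 0 \<Longrightarrow> \<exists>s. pw s < e"
proof -
  assume "e > 0"
  then obtain n where "(1 / real p) ^ n < e"
    using real_arch_pow_inv[of e "1 / real p"] p_gt_1 by auto
  then have "pw (- int n) < e" by (simp add: power_int_minus power_one_over field_simps)
  then show ?thesis by blast
qed

lemma ex_pw_greater: "\<exists>s\<ge>0. x < pw s"
proof -
  obtain n where "x < real p ^ n" using real_arch_pow[of "real p" x] p_gt_1 by auto
  then show ?thesis by (intro exI[of _ "int n"]) auto
qed

lemma av_0 [simp]: "av 0 = 0" by (simp add: pabs_rat_def)
lemma av_nonneg [simp]: "av q \<ge> 0" by (simp add: pabs_rat_def)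
lemma av_eq_0_iff [simp]: "av q = 0 \<longleftrightarrow> q = 0" using p_gt_0 by (simp add: pabs_rat_def)
lemma av_pos_iff [simp]: "av q > 0 \<longleftrightarrow> q \<noteq> 0" using p_gt_0 by (simp add: pabs_rat_def)
lemma ex_av_eq_pw: "q \<noteq> 0 \<Longrightarrow> \<exists>s. av q = pw s" by (auto simp: pabs_rat_def)

lemma prime_int: "prime (int p)" using prime by simp
lemma prime_elem_int: "prime_elem (int p)" using prime_int by blast

text \<open>The definition reads the valuation off the reduced fraction; cross multiplication shows
  that every other numerator and denominator give the same difference.\<close>

lemma av_quotient:
  assumes "a \<noteq> 0" "b \<noteq> 0"
  shows "av (of_int a / of_int b) = pw (int (multiplicity (int p) b) - int (multiplicity (int p) a))"
proof -
  obtain a' b' where q: "quotient_of (of_int a / of_int b) = (a', b')" by force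
  have b': "b' > 0" using quotient_of_denom_pos[OF q] .
  have eq: "of_int a / of_int b = (of_int a' / of_int b' :: rat)" using quotient_of_div[OF q] .
  then have "of_int (a * b') = (of_int (a' * b) :: rat)" using assms b' by (simp add: field_simps)
  then have ab: "a * b' = a' * b" by (simp only: of_int_eq_iff)
  then have a': "a' \<noteq> 0" using assms b' by auto
  have "multiplicity (int p) a + multiplicity (int p) b' = multiplicity (int p) a' + multiplicity (int p) b"
    using arg_cong[OF ab, of "multiplicity (int p)"] assms a' b' prime_elem_int
    by (simp add: prime_elem_multiplicity_mult_distrib)
  then have "- (int (multiplicity (int p) a') - int (multiplicity (int p) b'))
      = int (multiplicity (int p) b) - int (multiplicity (int p) a)" by linarith
  then show ?thesis using assms q by (simp only: pabs_rat_def padic_val_rat_def) simp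
qed

lemma av_of_int: "a \<noteq> 0 \<Longrightarrow> av (of_int a) = pw (- int (multiplicity (int p) a))"
  using av_quotient[of a 1] by simp

lemma ex_quotient: fixes q :: rat obtains a b :: int where "q = of_int a / of_int b" "b \<noteq> 0"
proof -
  obtain a b where q: "quotient_of q = (a, b)" by force
  show ?thesis using quotient_of_div[OF q] quotient_of_denom_pos[OF q] by (intro that[of a b]) auto
qed

lemma av_mult: "av (x * y) = av x * av y"
proof (cases "x = 0 \<or> y = 0")
  case False
  obtain a b where x: "x = of_int a / of_int b" "b \<noteq> 0" by (rule ex_quotient)
  obtain c d where y: "y = of_int c / of_int d" "d \<noteq> 0" by (rule ex_quotient)
  have nz: "a \<noteq> 0" "c \<noteq> 0" using False x y by auto
  have "x * y = of_int (a * c) / of_int (b * d)" using x y by simp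
  moreover have "a * c \<noteq> 0" "b * d \<noteq> 0" using x y nz by auto
  moreover have "int (multiplicity (int p) (b * d)) - int (multiplicity (int p) (a * c))
     = (int (multiplicity (int p) b) - int (multiplicity (int p) a)) + (int (multiplicity (int p) d) - int (multiplicity (int p) c))"
    using x y nz prime_elem_int by (simp add: prime_elem_multiplicity_mult_distrib)
  ultimately show ?thesis
    using x y av_quotient[of "a * c" "b * d"] av_quotient[OF nz(1) x(2)] av_quotient[OF nz(2) y(2)]
    by (simp only: pw_add simp_thms not_False_eq_True)
qed auto

lemma av_1 [simp]: "av 1 = 1" using av_of_int[of 1] by simp

lemma av_power: "av (x ^ n) = av x ^ n"
  by (induction n) (auto simp: av_mult)

lemma av_minus [simp]: "av (- x) = av x"
proof -
  have "av (- 1) = 1" using av_of_int[of "-1"] multiplicity_unit_right[of "-1" "int p"] by simp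
  then show ?thesis using av_mult[of "-1" x] by simp
qed

lemma av_minus_commute: "av (x - y) = av (y - x)"
  using av_minus[of "x - y"] by simp

lemma av_of_int_le_1: "av (of_int a) \<le> 1"
  using pw_le_iff[of "- int (multiplicity (int p) a)" 0] by (cases "a = 0") (auto simp: av_of_int simp del: pw_le_iff)

lemma av_rp [simp]: "av (rp s) = pw (- s)"
proof -
  have 1: "av (of_nat p) = pw (-1)"
    using av_of_int[of "int p"] p_gt_0 prime_int by (simp add: multiplicity_self not_prime_unit)
  have 2: "av (rp (int n)) = pw (- int n)" for n
    by (simp add: av_power 1 power_int_minus power_inverse)
  show ?thesis
  proof (cases s rule: int_cases2)
    case (nonneg n) then show ?thesis using 2 by simp
  next
    case (nonpos n)
    have "av (rp s) * av (rp (int n)) = 1"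
      using nonpos by (simp only: av_mult[symmetric] rp_add[symmetric]) simp
    then have "av (rp s) * pw (- int n) = pw (int n) * pw (- int n)"
      unfolding 2 pw_add[symmetric] by simp
    then show ?thesis using nonpos by (metis mult_right_cancel pw_neq_0 minus_minus)
  qed
qed

text \<open>The ultrametric inequality in the form used throughout: a bound by a fixed power of
  \<open>p\<close> is stable under addition, so estimates never need to be halved. Over a common
  denominator it is divisibility of a sum.\<close>

lemma av_add_le: assumes "av x \<le> pw s" "av y \<le> pw s" shows "av (x + y) \<le> pw s"
proof (cases "x = 0 \<or> y = 0 \<or> x + y = 0")
  case False
  obtain a b where x: "x = of_int a / of_int b" "b \<noteq> 0" by (rule ex_quotient)
  obtain c d where y: "y = of_int c / of_int d" "d \<noteq> 0" by (rule ex_quotient)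
  define u v w where "u = a * d" and "v = c * b" and "w = b * d"
  have w: "w \<noteq> 0" using x y by (simp add: w_def)
  have xq: "x = of_int u / of_int w" and yq: "y = of_int v / of_int w"
    using x y by (auto simp: u_def v_def w_def field_simps)
  have s: "x + y = of_int (u + v) / of_int w" by (simp add: xq yq add_divide_distrib)
  have nz: "u \<noteq> 0" "v \<noteq> 0" "u + v \<noteq> 0" using False w xq yq s by auto
  let ?m = "multiplicity (int p)"
  have "int p ^ min (?m u) (?m v) dvd u + v"
    by (intro dvd_add multiplicity_dvd') auto
  then have "min (?m u) (?m v) \<le> ?m (u + v)"
    using nz p_gt_1 by (intro multiplicity_geI) (auto simp: zdvd1_eq)
  then show ?thesis
    using assms av_quotient[OF nz(1) w] av_quotient[OF nz(2) w] av_quotient[OF nz(3) w]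
    by (simp only: xq[symmetric] yq[symmetric] s[symmetric] pw_le_iff)
qed (use assms in auto)

lemma av_diff_le: "av x \<le> pw s \<Longrightarrow> av y \<le> pw s \<Longrightarrow> av (x - y) \<le> pw s"
  using av_add_le[of x s "- y"] by simp

lemma av_diff_trans: "av (x - y) \<le> pw s \<Longrightarrow> av (y - z) \<le> pw s \<Longrightarrow> av (x - z) \<le> pw s"
  using av_add_le[of "x - y" s "y - z"] by simp

lemma av_sum_le: "(\<And>i. i \<in> I \<Longrightarrow> av (f i) \<le> pw s) \<Longrightarrow> av (sum f I) \<le> pw s"
proof (induction I rule: infinite_finite_induct)
  case (insert i I)
  then show ?case using av_add_le[of "f i" s "sum f I"] by simp
qed simp_all

text \<open>The isosceles principle. Nonzero values are powers of \<open>p\<close>, so the strict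
  inequality improves to the next lower power and the ultrametric inequality applies in both
  directions.\<close>

lemma av_eq_of_diff_less:
  assumes "av (x - y) < av x" shows "av y = av x"
proof -
  have x: "x \<noteq> 0" using assms by (metis av_0 av_nonneg not_le)
  obtain s where s: "av x = pw s" using ex_av_eq_pw[OF x] by blast
  have d: "av (x - y) \<le> pw (s - 1)"
  proof (cases "x = y")
    case False
    then obtain t where t: "av (x - y) = pw t" using ex_av_eq_pw[of "x - y"] by auto
    then have "\<not> s \<le> t" using assms s pw_le_iff by (metis not_le)
    then show ?thesis using t by simp
  qed auto
  then have "av y \<le> pw s" using av_diff_le[of x s "x - y"] s by (simp add: order_trans[OF d])
  moreover have "\<not> av y \<le> pw (s - 1)"
  proof
    assume "av y \<le> pw (s - 1)"
    then have "av x \<le> pw (s - 1)" using av_add_le[OF d, of y] by simp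
    then show False using s by simp
  qed
  moreover have "y \<noteq> 0" using assms by auto
  then obtain t where "av y = pw t" using ex_av_eq_pw by blast
  ultimately show ?thesis using s by (simp add: not_le)
qed

text \<open>The ring \<open>\<int>[1/p]\<close>, dense in the \<open>p\<close>-adic numbers.\<close>
definition pfrac :: "rat set" where
  "pfrac = {q. \<exists>u e. q = of_int u / of_nat p ^ e}"

lemma pfracI: "of_int u / of_nat p ^ e \<in> pfrac" by (auto simp: pfrac_def)

lemma pfrac_of_int [simp]: "of_int u \<in> pfrac"
  using pfracI[of u 0] by simp

lemma pfrac_of_nat [simp]: "of_nat u \<in> pfrac"
  using pfrac_of_int[of "int u"] by simp

lemma pfrac_0 [simp]: "0 \<in> pfrac" and pfrac_1 [simp]: "1 \<in> pfrac"
  using pfrac_of_int[of 0] pfrac_of_int[of 1] by auto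

lemma pfrac_common:
  assumes "q \<in> pfrac" obtains e0 where "\<And>e. e \<ge> e0 \<Longrightarrow> \<exists>u. q = of_int u / of_nat p ^ e"
proof -
  obtain u e0 where q: "q = of_int u / of_nat p ^ e0" using assms by (auto simp: pfrac_def)
  have "\<exists>u. q = of_int u / of_nat p ^ e" if "e \<ge> e0" for e
  proof
    have "(of_nat p :: rat) ^ e = of_nat p ^ e0 * of_nat p ^ (e - e0)"
      using that by (simp add: power_add[symmetric])
    then show "q = of_int (u * int p ^ (e - e0)) / of_nat p ^ e"
      unfolding q using p_gt_0 by (simp add: field_simps)
  qed
  then show ?thesis using that by blast
qed

lemma pfrac_add: assumes "x \<in> pfrac" "y \<in> pfrac" shows "x + y \<in> pfrac"
proof -
  obtain e1 where 1: "\<And>e. e \<ge> e1 \<Longrightarrow> \<exists>u. x = of_int u / of_nat p ^ e" using pfrac_common assms(1) by blast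
  obtain e2 where 2: "\<And>e. e \<ge> e2 \<Longrightarrow> \<exists>u. y = of_int u / of_nat p ^ e" using pfrac_common assms(2) by blast
  obtain u v where "x = of_int u / of_nat p ^ max e1 e2" "y = of_int v / of_nat p ^ max e1 e2"
    using 1[of "max e1 e2"] 2[of "max e1 e2"] by auto
  then have "x + y = of_int (u + v) / of_nat p ^ max e1 e2" by (simp add: add_divide_distrib)
  then show ?thesis using pfracI by metis
qed

lemma pfrac_mult: assumes "x \<in> pfrac" "y \<in> pfrac" shows "x * y \<in> pfrac"
proof -
  obtain u e v f where "x = of_int u / of_nat p ^ e" "y = of_int v / of_nat p ^ f"
    using assms by (auto simp: pfrac_def)
  then have "x * y = of_int (u * v) / of_nat p ^ (e + f)" by (simp add: power_add)
  then show ?thesis using pfracI by metis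
qed

lemma pfrac_diff: "x \<in> pfrac \<Longrightarrow> y \<in> pfrac \<Longrightarrow> x - y \<in> pfrac"
  using pfrac_add[of x "of_int (-1) * y"] pfrac_mult[of "of_int (-1)" y] pfrac_of_int[of "-1"] by simp

lemma pfrac_power: "x \<in> pfrac \<Longrightarrow> x ^ n \<in> pfrac"
  by (induction n) (auto intro: pfrac_mult)

lemma pfrac_rp [simp]: "rp s \<in> pfrac"
proof (cases s rule: int_cases2)
  case (nonneg n)
  then show ?thesis by (simp add: pfrac_power)
next
  case (nonpos n)
  then show ?thesis using pfracI[of 1 n] by (simp add: power_int_minus field_simps)
qed

text \<open>The reason for approximating inside \<open>pfrac\<close>: for a general rational such as
  \<open>1 / (p + 1)\<close> this fails, whereas here closeness modulo the \<open>p\<close>-adic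
  integers means congruence modulo ordinary integers, which \<open>cis (2 * pi * q)\<close>
  respects.\<close>

lemma pfrac_int: assumes "q \<in> pfrac" "av q \<le> 1" shows "q \<in> \<int>"
proof (cases "q = 0")
  case False
  obtain u e where q: "q = of_int u / of_nat p ^ e" using assms by (auto simp: pfrac_def)
  have u: "u \<noteq> 0" using q False by auto
  have "q = of_int u / of_int (int p ^ e)" using q by simp
  then have "av q = pw (int e - int (multiplicity (int p) u))"
    using u p_gt_0 prime_int av_quotient[of u "int p ^ e"]
    by (simp add: multiplicity_same_power not_prime_unit del: of_int_power)
  then have "e \<le> multiplicity (int p) u" using assms(2) pw_le_iff[of _ 0] by simp
  then have "int p ^ e dvd u" by (simp add: multiplicity_dvd')
  then show ?thesis using q p_gt_0 by (auto elim!: dvdE)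
qed auto

lemma pfrac_av_le:
  assumes "q \<in> pfrac" "av q \<le> pw s" obtains u where "q = of_int u * rp (- s)"
proof -
  have "av (q * rp s) \<le> pw s * pw (- s)" by (simp add: av_mult assms mult_right_mono)
  also have "\<dots> = 1" unfolding pw_add[symmetric] by simp
  finally have "q * rp s \<in> \<int>" using assms by (intro pfrac_int pfrac_mult) auto
  then obtain u where u: "q * rp s = of_int u" by (auto elim: Ints_cases)
  have "q = (q * rp s) * rp (- s)" by (simp add: mult.assoc rp_add[symmetric])
  then show ?thesis using that[of u] unfolding u by blast
qed

text \<open>Write the denominator as \<open>p^e * b'\<close> with \<open>b'\<close> prime to
  \<open>p\<close>. Bezout gives an inverse \<open>c\<close> of \<open>b'\<close> modulo
  \<open>p^k\<close>, and replacing \<open>1 / b'\<close> by \<open>c\<close> makes an error of size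
  at most \<open>p^(e-k)\<close>, so \<open>k\<close> is chosen from \<open>e - s\<close>.\<close>

lemma pfrac_approx: "\<exists>q'\<in>pfrac. av (q - q') \<le> pw s"
proof (cases "q = 0")
  case False
  obtain a b where q: "q = of_int a / of_int b" "b \<noteq> 0" by (rule ex_quotient)
  define e where "e = multiplicity (int p) b"
  obtain b' where b: "b = int p ^ e * b'" and nb: "\<not> int p dvd b'"
    using multiplicity_decompose'[of b "int p"] q prime_int not_prime_unit e_def by metis
  define k where "k = nat (int e - s)"
  have "coprime (int p ^ k) b'" using nb prime_int by (simp add: prime_imp_coprime)
  then obtain c d where cd: "d * int p ^ k + c * b' = 1"
    by (metis coprime_imp_gcd_eq_1 bezout_int)
  have b'0: "b' \<noteq> 0" using nb by auto
  have "(of_int d * of_nat p ^ k + of_int c * of_int b' :: rat) = 1"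
    using arg_cong[OF cd, of "of_int :: int \<Rightarrow> rat"] by simp
  then have 1: "(1 - of_int c * of_int b' :: rat) = of_int d * of_nat p ^ k" by (simp add: algebra_simps)
  have "q - of_int (a * c) / of_nat p ^ e
     = of_int a * (1 - of_int c * of_int b') / (of_nat p ^ e * of_int b')"
    using q b b'0 p_gt_0 by (simp add: field_simps)
  also have "\<dots> = of_int (a * d) * rp (int k - int e) * (of_int 1 / of_int b')"
    unfolding 1 using p_gt_0 by (simp add: power_int_diff)
  finally have "av (q - of_int (a * c) / of_nat p ^ e)
      = av (of_int (a * d)) * pw (int e - int k) * av (of_int 1 / of_int b')"
    by (simp only: av_mult av_rp minus_diff_eq)
  also have "av (of_int 1 / of_int b') = 1"
    using nb av_quotient[of 1 b'] b'0 by (simp add: not_dvd_imp_multiplicity_0)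
  also have "av (of_int (a * d)) * pw (int e - int k) * 1 \<le> 1 * pw (int e - int k) * 1"
    by (intro mult_right_mono av_of_int_le_1) auto
  also have "\<dots> \<le> pw s" by (simp add: k_def)
  finally show ?thesis using pfracI by blast
qed (use pfrac_0 in \<open>auto intro!: bexI[of _ 0]\<close>)

section \<open>Cauchy sequences and the field of p-adic numbers\<close>

lemma pcauchyD:
  assumes "pcauchy p f"
  shows "\<exists>N. \<forall>m\<ge>N. \<forall>n\<ge>N. av (f m - f n) \<le> pw s"
proof -
  obtain N where "\<forall>m\<ge>N. \<forall>n\<ge>N. av (f m - f n) < pw s"
    using assms pw_pos unfolding pcauchy_def by blast
  then show ?thesis by (meson less_imp_le)
qed

lemma pcauchyI:
  assumes "\<And>s. \<exists>N. \<forall>m\<ge>N. \<forall>n\<ge>N. av (f m - f n) \<le> pw s"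
  shows "pcauchy p f"
  unfolding pcauchy_def
proof (intro allI impI)
  fix e :: real assume "e > 0"
  then obtain s where s: "pw s < e" using ex_pw_less by blast
  obtain N where "\<forall>m\<ge>N. \<forall>n\<ge>N. av (f m - f n) \<le> pw s" using assms by blast
  then show "\<exists>N. \<forall>m\<ge>N. \<forall>n\<ge>N. av (f m - f n) < e" using s by (meson le_less_trans)
qed

lemma pnull_iff: "pnull p f \<longleftrightarrow> (\<forall>s. \<forall>\<^sub>F n in sequentially. av (f n) \<le> pw s)"
proof
  assume f: "pnull p f"
  show "\<forall>s. \<forall>\<^sub>F n in sequentially. av (f n) \<le> pw s"
  proof
    fix s
    obtain N where "\<forall>n\<ge>N. av (f n) < pw s" using f pw_pos unfolding pnull_def by blast
    then show "\<forall>\<^sub>F n in sequentially. av (f n) \<le> pw s"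
      unfolding eventually_sequentially by (meson less_imp_le)
  qed
next
  assume f: "\<forall>s. \<forall>\<^sub>F n in sequentially. av (f n) \<le> pw s"
  show "pnull p f"
    unfolding pnull_def
  proof (intro allI impI)
    fix e :: real assume "e > 0"
    then obtain s where s: "pw s < e" using ex_pw_less by blast
    obtain N where "\<forall>n\<ge>N. av (f n) \<le> pw s" using f unfolding eventually_sequentially by blast
    then show "\<exists>N. \<forall>n\<ge>N. av (f n) < e" using s by (meson le_less_trans)
  qed
qed

lemma pcauchy_const [simp]: "pcauchy p (\<lambda>_. q)"
  by (simp add: pcauchy_def)

lemma pnull_0 [simp]: "pnull p (\<lambda>_. 0)"
  by (simp add: pnull_def)

lemma pcauchy_bdd:
  assumes "pcauchy p f" shows "\<exists>s. \<forall>\<^sub>F n in sequentially. av (f n) \<le> pw s"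
proof -
  obtain N where N: "\<forall>m\<ge>N. \<forall>n\<ge>N. av (f m - f n) \<le> pw 0" using pcauchyD[OF assms] by blast
  obtain s where s: "s \<ge> 0" "av (f N) < pw s" using ex_pw_greater by blast
  have "av (f n) \<le> pw s" if "n \<ge> N" for n
  proof -
    have "av (f n - f N) \<le> pw 0" using N that by blast
    also have "\<dots> \<le> pw s" using s(1) pw_le_iff by blast
    finally show ?thesis using av_add_le[of "f n - f N" s "f N"] s by simp
  qed
  then show ?thesis unfolding eventually_sequentially by blast
qed

lemma pcauchy_add:
  assumes "pcauchy p f" "pcauchy p g" shows "pcauchy p (\<lambda>n. f n + g n)"
proof (rule pcauchyI)
  fix s
  obtain N where N: "\<forall>m\<ge>N. \<forall>n\<ge>N. av (f m - f n) \<le> pw s" using pcauchyD assms(1) by blast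
  obtain M where M: "\<forall>m\<ge>M. \<forall>n\<ge>M. av (g m - g n) \<le> pw s" using pcauchyD assms(2) by blast
  have "av ((f m + g m) - (f n + g n)) \<le> pw s" if "m \<ge> max M N" "n \<ge> max M N" for m n
    using av_add_le[of "f m - f n" s "g m - g n"] N M that by (simp add: algebra_simps)
  then show "\<exists>N. \<forall>m\<ge>N. \<forall>n\<ge>N. av ((f m + g m) - (f n + g n)) \<le> pw s" by blast
qed

lemma av_mult_le:
  assumes "av x \<le> pw s" "av y \<le> pw t" shows "av (x * y) \<le> pw (s + t)"
  unfolding av_mult pw_add using assms by (intro mult_mono) auto

lemma pcauchy_mult:
  assumes "pcauchy p f" "pcauchy p g" shows "pcauchy p (\<lambda>n. f n * g n)"
proof (rule pcauchyI)
  fix s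
  obtain a N1 where a: "\<forall>n\<ge>N1. av (f n) \<le> pw a"
    using pcauchy_bdd[OF assms(1)] unfolding eventually_sequentially by blast
  obtain b N2 where b: "\<forall>n\<ge>N2. av (g n) \<le> pw b"
    using pcauchy_bdd[OF assms(2)] unfolding eventually_sequentially by blast
  obtain N where N: "\<forall>m\<ge>N. \<forall>n\<ge>N. av (f m - f n) \<le> pw (s - b)" using pcauchyD assms(1) by blast
  obtain M where M: "\<forall>m\<ge>M. \<forall>n\<ge>M. av (g m - g n) \<le> pw (s - a)" using pcauchyD assms(2) by blast
  let ?L = "max (max N1 N2) (max M N)"
  have "av (f m * g m - f n * g n) \<le> pw s" if "m \<ge> ?L" "n \<ge> ?L" for m n
  proof -
    have "av (f m * (g m - g n)) \<le> pw (a + (s - a))" using a M that by (intro av_mult_le) auto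
    moreover have "av ((f m - f n) * g n) \<le> pw ((s - b) + b)" using b N that by (intro av_mult_le) auto
    ultimately show ?thesis using av_add_le[of "f m * (g m - g n)" s "(f m - f n) * g n"]
      by (simp add: algebra_simps)
  qed
  then show "\<exists>N. \<forall>m\<ge>N. \<forall>n\<ge>N. av (f m * g m - f n * g n) \<le> pw s" by blast
qed

lemma pcauchy_minus: "pcauchy p f \<Longrightarrow> pcauchy p (\<lambda>n. - f n)"
  using pcauchy_mult[OF pcauchy_const[of "-1"], of f] by simp

lemma pnull_add:
  assumes "pnull p f" "pnull p g" shows "pnull p (\<lambda>n. f n + g n)"
  unfolding pnull_iff
proof
  fix s
  show "\<forall>\<^sub>F n in sequentially. av (f n + g n) \<le> pw s"
    using assms[unfolded pnull_iff, rule_format, of s] by eventually_elim (rule av_add_le)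
qed

lemma pnull_minus: "pnull p f \<Longrightarrow> pnull p (\<lambda>n. - f n)"
  by (simp add: pnull_def)

lemma pnull_mult:
  assumes "pnull p f" "pcauchy p g" shows "pnull p (\<lambda>n. f n * g n)"
  unfolding pnull_iff
proof
  fix s
  obtain b where b: "\<forall>\<^sub>F n in sequentially. av (g n) \<le> pw b" using pcauchy_bdd[OF assms(2)] by blast
  have "\<forall>\<^sub>F n in sequentially. av (f n * g n) \<le> pw ((s - b) + b)"
    using assms(1)[unfolded pnull_iff, rule_format, of "s - b"] b by eventually_elim (rule av_mult_le)
  then show "\<forall>\<^sub>F n in sequentially. av (f n * g n) \<le> pw s" by simp
qed

section \<open>Classes of Cauchy sequences and arithmetic on representatives\<close>

lemma mem_pcls_iff: "g \<in> pcls p f \<longleftrightarrow> pcauchy p g \<and> pnull p (\<lambda>n. f n - g n)"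
  by (simp add: pcls_def)

lemma pnull_diff_trans:
  assumes "pnull p (\<lambda>n. f n - g n)" "pnull p (\<lambda>n. g n - h n)" shows "pnull p (\<lambda>n. f n - h n)"
  using pnull_add[OF assms] by simp

lemma pnull_diff_commute: "pnull p (\<lambda>n. f n - g n) \<Longrightarrow> pnull p (\<lambda>n. g n - f n)"
  using pnull_minus[of "\<lambda>n. f n - g n"] by simp

lemma pcls_eqI: "pnull p (\<lambda>n. f n - g n) \<Longrightarrow> pcls p f = pcls p g"
  unfolding pcls_def by (auto intro: pnull_diff_trans pnull_diff_commute)

lemma self_mem_pcls: "pcauchy p f \<Longrightarrow> f \<in> pcls p f"
  by (simp add: mem_pcls_iff)

lemma pcls_in_Qp: "pcauchy p f \<Longrightarrow> pcls p f \<in> Qp p"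
  by (auto simp: Qp_def)

lemma Qp_memD:
  assumes "x \<in> Qp p" "f \<in> x" shows "pcauchy p f" "x = pcls p f"
proof -
  obtain g where x: "x = pcls p g" using assms by (auto simp: Qp_def)
  then have f: "pcauchy p f" "pnull p (\<lambda>n. g n - f n)" using assms by (auto simp: mem_pcls_iff)
  then show "pcauchy p f" "x = pcls p f" using x pcls_eqI by auto
qed

lemma Qp_mem_pnull: "x \<in> Qp p \<Longrightarrow> f \<in> x \<Longrightarrow> g \<in> x \<Longrightarrow> pnull p (\<lambda>n. f n - g n)"
  using Qp_memD(2) mem_pcls_iff by blast

lemma prep_mem: "x \<in> Qp p \<Longrightarrow> prep x \<in> x"
  unfolding prep_def using self_mem_pcls by (intro someI_ex[of "\<lambda>f. f \<in> x"]) (auto simp: Qp_def)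

lemma pof_rat_Qp [simp]: "pof_rat p q \<in> Qp p" and pof_rat_mem: "(\<lambda>_. q) \<in> pof_rat p q"
  by (simp_all add: pof_rat_def pcls_in_Qp self_mem_pcls)

lemma pcls_mem:
  assumes "pcauchy p f" "pcauchy p g" "pnull p (\<lambda>n. f n - g n)"
  shows "pcls p f \<in> Qp p \<and> g \<in> pcls p f"
  using assms by (simp add: pcls_in_Qp mem_pcls_iff)

text \<open>The operations are defined through the chosen \<open>prep\<close>. This lemma and its
  analogues for \<open>psub\<close> and \<open>pmul\<close> allow arbitrary representatives, so that
  polynomials can be evaluated termwise on sequences.\<close>

lemma padd_mem:
  assumes "x \<in> Qp p" "y \<in> Qp p" "f \<in> x" "g \<in> y"
  shows "padd p x y \<in> Qp p \<and> (\<lambda>n. f n + g n) \<in> padd p x y"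
  unfolding padd_def
proof (rule pcls_mem)
  have "pnull p (\<lambda>n. (prep x n - f n) + (prep y n - g n))"
    by (intro pnull_add Qp_mem_pnull[OF assms(1) prep_mem] Qp_mem_pnull[OF assms(2) prep_mem] assms)
  then show "pnull p (\<lambda>n. (prep x n + prep y n) - (f n + g n))" by (simp add: algebra_simps)
qed (use assms prep_mem Qp_memD(1) in \<open>blast intro: pcauchy_add\<close>)+

lemma psub_mem:
  assumes "x \<in> Qp p" "y \<in> Qp p" "f \<in> x" "g \<in> y"
  shows "psub p x y \<in> Qp p \<and> (\<lambda>n. f n - g n) \<in> psub p x y"
  unfolding psub_def
proof (rule pcls_mem)
  have "pnull p (\<lambda>n. (prep x n - f n) + - (prep y n - g n))"
    by (intro pnull_add pnull_minus Qp_mem_pnull[OF assms(1) prep_mem] Qp_mem_pnull[OF assms(2) prep_mem] assms)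
  then show "pnull p (\<lambda>n. (prep x n - prep y n) - (f n - g n))" by (simp add: algebra_simps)
  have "pcauchy p (\<lambda>n. u n - v n)" if "pcauchy p u" "pcauchy p v" for u v
    using pcauchy_add[OF that(1) pcauchy_minus[OF that(2)]] by simp
  then show "pcauchy p (\<lambda>n. prep x n - prep y n)" "pcauchy p (\<lambda>n. f n - g n)"
    using assms prep_mem Qp_memD(1) by blast+
qed

lemma pmul_mem:
  assumes "x \<in> Qp p" "y \<in> Qp p" "f \<in> x" "g \<in> y"
  shows "pmul p x y \<in> Qp p \<and> (\<lambda>n. f n * g n) \<in> pmul p x y"
  unfolding pmul_def
proof (rule pcls_mem)
  have "pnull p (\<lambda>n. (prep x n - f n) * prep y n + (prep y n - g n) * f n)"
    using assms by (intro pnull_add pnull_mult Qp_mem_pnull) (auto intro: prep_mem Qp_memD(1))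
  then show "pnull p (\<lambda>n. (prep x n * prep y n) - (f n * g n))" by (simp add: algebra_simps)
qed (use assms prep_mem Qp_memD(1) in \<open>blast intro: pcauchy_mult\<close>)+

lemma ppow_mem:
  assumes "x \<in> Qp p" "f \<in> x"
  shows "ppow p x k \<in> Qp p \<and> (\<lambda>n. f n ^ k) \<in> ppow p x k"
  by (induction k) (use assms pof_rat_mem pmul_mem in auto)

lemma psum_mem:
  assumes "\<And>i. i < k \<Longrightarrow> a i \<in> Qp p \<and> f i \<in> a i"
  shows "psum p a k \<in> Qp p \<and> (\<lambda>n. \<Sum>i<k. f i n) \<in> psum p a k"
  using assms
proof (induction k)
  case 0
  then show ?case using pof_rat_mem by simp
next
  case (Suc k)
  then show ?case using padd_mem[of "psum p a k" "a k" "\<lambda>n. \<Sum>i<k. f i n" "f k"] by simp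
qed

lemma ppoly_mem:
  assumes "\<And>i. i \<le> n \<Longrightarrow> a i \<in> Qp p \<and> A i \<in> a i" "x \<in> Qp p" "f \<in> x"
  shows "ppoly p a n x \<in> Qp p \<and> (\<lambda>m. \<Sum>i\<le>n. A i m * f m ^ i) \<in> ppoly p a n x"
  unfolding ppoly_def lessThan_Suc_atMost[symmetric]
  by (rule psum_mem, rule pmul_mem) (use assms ppow_mem in auto)

text \<open>If the sequence is not null, it has a late term exceeding all later differences, and the
  isosceles principle then freezes the absolute value. Hence the limit in \<open>pabs\<close>
  exists, is attained, and can be read off any representative.\<close>

lemma pabs_cases:
  assumes x: "x \<in> Qp p" and f: "f \<in> x"
  shows "(pabs p x = 0 \<and> pnull p f) \<or> (\<exists>s. pabs p x = pw s \<and> (\<forall>\<^sub>F n in sequentially. av (f n) = pw s))"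
proof -
  define g where "g = prep x"
  have g: "g \<in> x" using prep_mem[OF x] by (simp add: g_def)
  have fg: "pnull p (\<lambda>n. f n - g n)" using Qp_mem_pnull[OF x f g] .
  show ?thesis
  proof (cases "pnull p g")
    case True
    have "(\<lambda>n. av (g n)) \<longlonglongrightarrow> 0"
    proof (rule LIMSEQ_I)
      fix r :: real assume "r > 0"
      then show "\<exists>N. \<forall>n\<ge>N. norm (av (g n) - 0) < r" using True by (simp add: pnull_def)
    qed
    then have "pabs p x = 0" by (simp add: pabs_def g_def[symmetric] limI)
    moreover have "pnull p f" using pnull_add[OF fg True] by simp
    ultimately show ?thesis by blast
  next
    case False
    then obtain s where s: "\<exists>\<^sub>F n in sequentially. \<not> av (g n) \<le> pw s"
      by (auto simp: pnull_iff frequently_def)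
    obtain N where N: "\<forall>m\<ge>N. \<forall>n\<ge>N. av (g m - g n) \<le> pw s"
      using pcauchyD Qp_memD(1)[OF x g] by blast
    obtain M where M: "M \<ge> N" "\<not> av (g M) \<le> pw s"
      using s unfolding frequently_sequentially by blast
    have const: "av (g n) = av (g M)" if "n \<ge> N" for n
    proof (rule av_eq_of_diff_less)
      show "av (g M - g n) < av (g M)" using N M that by (meson le_less_trans not_le)
    qed
    have "g M \<noteq> 0" using M by auto
    then obtain t where t: "av (g M) = pw t" using ex_av_eq_pw by blast
    have ev: "\<forall>\<^sub>F n in sequentially. av (g n) = pw t"
      unfolding eventually_sequentially using const t by auto
    then have "(\<lambda>n. av (g n)) \<longlonglongrightarrow> pw t" by (simp add: tendsto_eventually)
    then have "pabs p x = pw t" by (simp add: pabs_def g_def[symmetric] limI)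
    moreover have "\<forall>\<^sub>F n in sequentially. av (f n) = pw t"
      using ev fg[unfolded pnull_iff, rule_format, of s]
        eventually_ge_at_top[of N]
    proof eventually_elim
      case (elim n)
      have "av (g n - f n) < av (g n)"
        using elim M(2) t unfolding av_minus_commute[of "g n"] not_le by linarith
      then show ?case using av_eq_of_diff_less elim by metis
    qed
    ultimately show ?thesis by blast
  qed
qed

lemma pabs_le_iff:
  assumes "x \<in> Qp p" "f \<in> x"
  shows "pabs p x \<le> pw s \<longleftrightarrow> (\<forall>\<^sub>F n in sequentially. av (f n) \<le> pw s)"
  using pabs_cases[OF assms]
proof
  assume "pabs p x = 0 \<and> pnull p f"
  then show ?thesis by (simp add: pnull_iff)
next
  assume "\<exists>s. pabs p x = pw s \<and> (\<forall>\<^sub>F n in sequentially. av (f n) = pw s)"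
  then obtain t where t: "pabs p x = pw t" "\<forall>\<^sub>F n in sequentially. av (f n) = pw t" by blast
  show ?thesis
  proof
    assume "pabs p x \<le> pw s"
    with t(2) show "\<forall>\<^sub>F n in sequentially. av (f n) \<le> pw s" by (auto elim!: eventually_mono simp: t(1))
  next
    assume "\<forall>\<^sub>F n in sequentially. av (f n) \<le> pw s"
    with t(2) have "\<forall>\<^sub>F n in sequentially. pw t \<le> pw s" by eventually_elim simp
    then show "pabs p x \<le> pw s" by (simp add: t(1))
  qed
qed

lemma pabs_pof_rat [simp]: "pabs p (pof_rat p q) = av q"
proof (cases "q = 0")
  case True
  then show ?thesis using pabs_cases[OF pof_rat_Qp pof_rat_mem, of 0] by auto
next
  case False
  then have "\<not> pnull p (\<lambda>_. q)" by (auto simp: pnull_def intro!: exI[of _ "av q"])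
  then show ?thesis using pabs_cases[OF pof_rat_Qp pof_rat_mem, of q] by auto
qed

section \<open>The ultrametric distance and approximation from the dense ring\<close>

abbreviation "pdist x y \<equiv> pabs p (psub p x y)"

lemma pdist_le_iff:
  assumes "x \<in> Qp p" "y \<in> Qp p" "f \<in> x" "g \<in> y"
  shows "pdist x y \<le> pw s \<longleftrightarrow> (\<forall>\<^sub>F n in sequentially. av (f n - g n) \<le> pw s)"
  using psub_mem[OF assms] pabs_le_iff by blast

lemma pdist_commute_le:
  assumes "x \<in> Qp p" "y \<in> Qp p" "pdist x y \<le> pw s" shows "pdist y x \<le> pw s"
  using assms pdist_le_iff[OF assms(1,2) prep_mem prep_mem] pdist_le_iff[OF assms(2,1) prep_mem prep_mem]
  by (simp add: av_minus_commute)

lemma pdist_trans: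
  assumes "x \<in> Qp p" "y \<in> Qp p" "z \<in> Qp p" "pdist x y \<le> pw s" "pdist y z \<le> pw s"
  shows "pdist x z \<le> pw s"
proof -
  have "\<forall>\<^sub>F n in sequentially. av (prep x n - prep y n) \<le> pw s"
    "\<forall>\<^sub>F n in sequentially. av (prep y n - prep z n) \<le> pw s"
    using assms pdist_le_iff prep_mem by blast+
  then have "\<forall>\<^sub>F n in sequentially. av (prep x n - prep z n) \<le> pw s"
    by eventually_elim (rule av_diff_trans)
  then show ?thesis using assms pdist_le_iff prep_mem by blast
qed

lemma pdist_pof_rat [simp]: "pdist (pof_rat p q) (pof_rat p q') \<le> pw s \<longleftrightarrow> av (q - q') \<le> pw s"
  using pdist_le_iff[OF _ _ pof_rat_mem pof_rat_mem] by simp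

lemma pdist_mono: "pdist x y \<le> pw s \<Longrightarrow> s \<le> t \<Longrightarrow> pdist x y \<le> pw t"
  by (meson order_trans pw_le_iff)

lemma pdist_common:
  assumes "x \<in> Qp p" "pdist x (pof_rat p q) \<le> pw s" "pdist x (pof_rat p q') \<le> pw s"
  shows "av (q - q') \<le> pw s"
  using pdist_trans[OF _ assms(1) _ pdist_commute_le[OF assms(1) _ assms(2)] assms(3)] by simp

lemma pdist_0 [simp]: "x \<in> Qp p \<Longrightarrow> pdist x (pof_rat p 0) \<le> pw s \<longleftrightarrow> pabs p x \<le> pw s"
  using pdist_le_iff[OF _ _ prep_mem pof_rat_mem] pabs_le_iff[OF _ prep_mem] by simp

lemma pabs_bdd: "x \<in> Qp p \<Longrightarrow> \<exists>s. pabs p x \<le> pw s"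
  using pabs_cases[OF _ prep_mem] by (metis order_refl pw_nonneg)

lemma pdist_approx:
  assumes "x \<in> Qp p" shows "\<exists>q\<in>pfrac. pdist x (pof_rat p q) \<le> pw s"
proof -
  obtain N where N: "\<forall>m\<ge>N. \<forall>n\<ge>N. av (prep x m - prep x n) \<le> pw s"
    using pcauchyD Qp_memD(1)[OF assms prep_mem[OF assms]] by blast
  obtain q where q: "q \<in> pfrac" "av (prep x N - q) \<le> pw s" using pfrac_approx by blast
  have "\<forall>\<^sub>F n in sequentially. av (prep x n - q) \<le> pw s"
    unfolding eventually_sequentially using N q(2) av_diff_trans by blast
  then show ?thesis using q(1) pdist_le_iff[OF assms pof_rat_Qp prep_mem[OF assms] pof_rat_mem] by blast
qed

section \<open>Standard expansions and the additive character\<close>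

lemma rp_Suc: "rp (j + 1) = of_nat p * rp j"
  using p_gt_0 by (intro power_int_add_1') simp

text \<open>On \<open>pfrac\<close> this is the \<open>p\<close>-adic digit, also for negative
  \<open>q\<close>: for \<open>q = -1\<close> and \<open>j \<ge> 0\<close> the floor is
  \<open>-1\<close>, giving the digit \<open>p - 1\<close>.\<close>

definition qdig :: "rat \<Rightarrow> int \<Rightarrow> nat" where
  "qdig q j = nat (\<lfloor>q * rp (- j)\<rfloor> mod int p)"

lemma qdig_less: "qdig q j < p"
  using p_gt_0 by (simp add: qdig_def nat_less_iff)

lemma qdig_0 [simp]: "qdig 0 j = 0"
  by (simp add: qdig_def)

text \<open>The two numbers differ by an integer multiple of \<open>p^(j+1)\<close>, so after
  scaling by \<open>p^(-j)\<close> the floors agree modulo \<open>p\<close>.\<close>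

lemma qdig_cong:
  assumes "q \<in> pfrac" "q' \<in> pfrac" "av (q - q') \<le> pw (- (j + 1))"
  shows "qdig q j = qdig q' j"
proof -
  obtain u where "q - q' = of_int u * rp (- (- (j + 1)))"
    using pfrac_av_le[OF pfrac_diff[OF assms(1,2)] assms(3)] by blast
  then have "q = q' + of_int u * rp (j + 1)" by (simp only: minus_minus diff_eq_eq add.commute)
  then have "q * rp (- j) = q' * rp (- j) + of_int u * (rp (j + 1) * rp (- j))"
    by (simp add: algebra_simps)
  also have "rp (j + 1) * rp (- j) = of_nat p" unfolding rp_add[symmetric] by simp
  finally have "q * rp (- j) = q' * rp (- j) + of_int (u * int p)" by simp
  then have "\<lfloor>q * rp (- j)\<rfloor> = \<lfloor>q' * rp (- j)\<rfloor> + u * int p" by (simp only: floor_add_int[symmetric])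
  then show ?thesis by (simp add: qdig_def)
qed

definition digits_from :: "int \<Rightarrow> (int \<Rightarrow> nat) \<Rightarrow> bool" where
  "digits_from k d \<longleftrightarrow> (\<forall>j. d j < p) \<and> (\<forall>j<k. d j = 0)"

abbreviation "psm d M \<equiv> pdigit_sum p d M"

lemma psm_below: "digits_from k d \<Longrightarrow> M < k \<Longrightarrow> psm d M = 0"
  unfolding pdigit_sum_def by (rule sum.neutral) (auto simp: digits_from_def)

lemma psm_Suc:
  assumes "digits_from k d"
  shows "psm d (M + 1) = psm d M + of_nat (d (M + 1)) * rp (M + 1)"
proof (cases "d (M + 1) = 0")
  case True
  have "{j. j \<le> M + 1 \<and> d j \<noteq> 0} = {j. j \<le> M \<and> d j \<noteq> 0}"
    using True by (auto simp: le_less zless_add1_eq)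
  then show ?thesis using True by (simp add: pdigit_sum_def)
next
  case False
  have "{j. j \<le> M + 1 \<and> d j \<noteq> 0} = insert (M + 1) {j. j \<le> M \<and> d j \<noteq> 0}"
    using False by (auto simp: le_less zless_add1_eq)
  moreover have "finite {j. j \<le> M \<and> d j \<noteq> 0}"
    by (rule finite_subset[of _ "{k..M}"]) (use assms in \<open>auto simp: digits_from_def not_less[symmetric]\<close>)
  ultimately show ?thesis by (simp add: pdigit_sum_def)
qed

text \<open>Digit sums run over all integers below \<open>M\<close>, so the base case is the whole
  half line \<open>M < k\<close>, where they vanish.\<close>

lemma psm_induct [consumes 1, case_names below step]:
  assumes "digits_from k d" "\<And>M. M < k \<Longrightarrow> psm d M = 0 \<Longrightarrow> P M"
    "\<And>M. P M \<Longrightarrow> psm d (M + 1) = psm d M + of_nat (d (M + 1)) * rp (M + 1) \<Longrightarrow> P (M + 1)"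
  shows "P M"
proof (cases "M < k")
  case True then show ?thesis using assms(2) psm_below[OF assms(1)] by blast
next
  case False
  then have "k - 1 \<le> M" by simp
  then show ?thesis
    by (induction M rule: int_ge_induct)
      (use assms(2)[of "k - 1"] psm_below[OF assms(1), of "k - 1"] assms(3) psm_Suc[OF assms(1)] in auto)
qed

lemma psm_dyad: assumes "digits_from k d" shows "psm d M \<in> pfrac"
  using assms
proof (induction M rule: psm_induct)
  case (step M)
  show ?case unfolding step(2) by (intro pfrac_add step(1) pfrac_mult pfrac_of_nat pfrac_rp)
qed simp

text \<open>A bound on the ordinary, not the \<open>p\<close>-adic, size; it lets
  \<open>floor\<close> cut off lower digits.\<close>

lemma psm_bounds: assumes "digits_from k d" shows "0 \<le> psm d M \<and> psm d M < rp (M + 1)"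
  using assms
proof (induction M rule: psm_induct)
  case (step M)
  have "(of_nat (d (M + 1)) + 1) * rp (M + 1) \<le> of_nat p * rp (M + 1)"
  proof (rule mult_right_mono)
    have "d (M + 1) + 1 \<le> p" using assms by (simp add: digits_from_def Suc_leI)
    then show "of_nat (d (M + 1)) + 1 \<le> (of_nat p :: rat)"
      by (metis of_nat_1 of_nat_add of_nat_le_iff)
  qed (simp add: less_imp_le)
  then have "(of_nat (d (M + 1)) + 1) * rp (M + 1) \<le> rp (M + 1 + 1)" by (simp only: rp_Suc[of "M + 1"])
  then show ?case using step by (simp add: distrib_right)
qed simp

lemma psm_diff:
  assumes "digits_from k d" "i \<le> M" obtains u where "psm d M - psm d i = of_int u * rp (i + 1)"
proof -
  have "\<exists>u. psm d M - psm d i = of_int u * rp (i + 1)"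
    using assms(2)
  proof (induction M rule: int_ge_induct)
    case base
    then show ?case by (intro exI[of _ 0]) simp
  next
    case (step M)
    then obtain u where u: "psm d M - psm d i = of_int u * rp (i + 1)" by blast
    have "rp (M + 1) = rp (int (nat (M - i))) * rp (i + 1)"
      using step(1) by (simp only: rp_add[symmetric]) (simp add: algebra_simps)
    also have "rp (int (nat (M - i))) = of_int (int p ^ nat (M - i))"
      by (simp only: power_int_of_nat of_int_power of_int_of_nat_eq)
    finally have "psm d (M + 1) - psm d i = of_int (u + int (d (M + 1)) * int p ^ nat (M - i)) * rp (i + 1)"
      using u psm_Suc[OF assms(1), of M] by (simp add: algebra_simps)
    then show ?case by blast
  qed
  then show ?thesis using that by blast
qed

lemma av_psm_diff:
  assumes "digits_from k d" "i \<le> M" shows "av (psm d M - psm d i) \<le> pw (- (i + 1))"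
proof -
  obtain u where "psm d M - psm d i = of_int u * rp (i + 1)" using psm_diff[OF assms] .
  then have "av (psm d M - psm d i) = av (of_int u) * pw (- (i + 1))" by (simp only: av_mult av_rp)
  also have "\<dots> \<le> 1 * pw (- (i + 1))" by (intro mult_right_mono av_of_int_le_1) simp
  finally show ?thesis by simp
qed

text \<open>After scaling by \<open>p^(-j)\<close> the digits below \<open>j\<close> contribute less
  than one and disappear in the floor; those above \<open>j\<close> contribute a multiple of
  \<open>p\<close> and disappear in \<open>mod\<close>.\<close>

lemma qdig_psm:
  assumes "digits_from k d" "j \<le> M" shows "qdig (psm d M) j = d j"
proof -
  obtain u where u: "psm d M - psm d j = of_int u * rp (j + 1)" using psm_diff[OF assms] .
  have sj: "psm d j = psm d (j - 1) + of_nat (d j) * rp j" using psm_Suc[OF assms(1), of "j - 1"] by simp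
  have r: "rp j * rp (- j) = 1" "rp (j + 1) * rp (- j) = of_nat p"
    unfolding rp_add[symmetric] by simp_all
  have "psm d M = psm d (j - 1) + of_nat (d j) * rp j + of_int u * rp (j + 1)" using u sj by simp
  then have "psm d M * rp (- j) = psm d (j - 1) * rp (- j) + of_nat (d j) * (rp j * rp (- j)) + of_int u * (rp (j + 1) * rp (- j))"
    by (simp add: algebra_simps)
  then have eq: "psm d M * rp (- j) = psm d (j - 1) * rp (- j) + of_int (int (d j) + u * int p)"
    unfolding r by simp
  have "0 \<le> psm d (j - 1) * rp (- j)" using psm_bounds[OF assms(1), of "j - 1"] by (simp add: less_imp_le)
  moreover have "psm d (j - 1) * rp (- j) < rp j * rp (- j)"
    using psm_bounds[OF assms(1), of "j - 1"] by (intro mult_strict_right_mono) auto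
  ultimately have "\<lfloor>psm d M * rp (- j)\<rfloor> = int (d j) + u * int p"
    unfolding eq r by (intro floor_unique) auto
  then show ?thesis using assms(1) by (simp add: qdig_def digits_from_def)
qed

lemma is_std_expansion_iff:
  "is_std_expansion p x d \<longleftrightarrow> (\<exists>k. digits_from k d) \<and>
     (\<forall>s. \<exists>N. \<forall>M\<ge>N. pdist x (pof_rat p (psm d M)) \<le> pw s)"
proof -
  have "(\<forall>e>0. \<exists>N. \<forall>M\<ge>N. pdist x (pof_rat p (psm d M)) < e)
     \<longleftrightarrow> (\<forall>s. \<exists>N. \<forall>M\<ge>N. pdist x (pof_rat p (psm d M)) \<le> pw s)"
    (is "?L \<longleftrightarrow> ?R")
  proof
    assume ?L then show ?R using pw_pos by (meson less_imp_le)
  next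
    assume ?R then show ?L using ex_pw_less by (meson le_less_trans)
  qed
  then show ?thesis unfolding is_std_expansion_def digits_from_def by blast
qed

lemma std_expansion_pdist:
  assumes "x \<in> Qp p" "is_std_expansion p x d"
  shows "pdist x (pof_rat p (psm d M)) \<le> pw (- (M + 1))"
proof -
  obtain k where k: "digits_from k d" using assms is_std_expansion_iff by blast
  obtain N where "\<forall>M'\<ge>N. pdist x (pof_rat p (psm d M')) \<le> pw (- (M + 1))"
    using assms is_std_expansion_iff by blast
  then have "pdist x (pof_rat p (psm d (max M N))) \<le> pw (- (M + 1))" by simp
  moreover have "pdist (pof_rat p (psm d (max M N))) (pof_rat p (psm d M)) \<le> pw (- (M + 1))"
    using av_psm_diff[OF k, of M "max M N"] by simp
  ultimately show ?thesis using pdist_trans[OF assms(1)] pof_rat_Qp by blast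
qed

lemma std_expansion_qdig:
  assumes "x \<in> Qp p" "is_std_expansion p x d" "q \<in> pfrac" "pdist x (pof_rat p q) \<le> pw (- (j + 1))"
  shows "d j = qdig q j"
proof -
  obtain k where k: "digits_from k d" using assms is_std_expansion_iff by blast
  have "av (psm d j - q) \<le> pw (- (j + 1))"
    using pdist_common[OF assms(1) std_expansion_pdist[OF assms(1,2)] assms(4)] .
  then show ?thesis
    using qdig_cong[OF psm_dyad[OF k] assms(3)] qdig_psm[OF k order_refl, of j] by simp
qed

lemma std_expansion_exists:
  assumes x: "x \<in> Qp p" shows "\<exists>d. is_std_expansion p x d"
proof -
  define A where "A = (\<lambda>s. SOME q. q \<in> pfrac \<and> pdist x (pof_rat p q) \<le> pw s)"
  have A: "A s \<in> pfrac" "pdist x (pof_rat p (A s)) \<le> pw s" for s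
    using someI_ex[of "\<lambda>q. q \<in> pfrac \<and> pdist x (pof_rat p q) \<le> pw s"] pdist_approx[OF x]
    unfolding A_def by blast+
  \<comment> \<open>A digit at \<open>j\<close> depends only on the class modulo
    \<open>p^(j+1)\<close>, so each may be taken from its own approximation;
    \<open>qdig_cong\<close> makes the choices consistent.\<close>
  define d where "d = (\<lambda>j. qdig (A (- (j + 1))) j)"
  have d: "d j = qdig q j" if "q \<in> pfrac" "pdist x (pof_rat p q) \<le> pw (- (j + 1))" for q j
    unfolding d_def by (intro qdig_cong A that pdist_common[OF x])
  obtain k0 where "pabs p x \<le> pw k0" using pabs_bdd[OF x] by blast
  define k where "k = - k0"
  have xk: "pdist x (pof_rat p 0) \<le> pw (- k)" using \<open>pabs p x \<le> pw k0\<close> x by (simp add: k_def)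
  have "d j = 0" if "j < k" for j
    using d[of 0 j] pdist_mono[OF xk, of "- (j + 1)"] that by simp
  then have df: "digits_from k d" by (simp add: digits_from_def d_def qdig_less)
  have close: "pdist x (pof_rat p (psm d M)) \<le> pw (- (M + 1))" if M: "M \<ge> k - 1" for M
  proof -
    define q where "q = A (- (M + 1))"
    have q: "q \<in> pfrac" "pdist x (pof_rat p q) \<le> pw (- (M + 1))" unfolding q_def by (rule A)+
    have dq: "d j = qdig q j" if "j \<le> M" for j
      using that by (intro d q pdist_mono[OF q(2)]) auto
    \<comment> \<open>The partial sum is the remainder of \<open>q\<close> modulo
      \<open>p^(i+1)\<close>. At \<open>i = k - 1\<close> this remainder is zero because
      \<open>q\<close> is a multiple of \<open>p^k\<close>; each step exposes one digit by dividing
      the floor by \<open>p\<close>.\<close>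
    have "psm d i = q - of_int \<lfloor>q * rp (- (i + 1))\<rfloor> * rp (i + 1)" if "k - 1 \<le> i" "i \<le> M" for i
      using that
    proof (induction i rule: int_ge_induct)
      case base
      have "pdist x (pof_rat p q) \<le> pw (- k)" by (rule pdist_mono[OF q(2)]) (use M in simp)
      then have "av (q - 0) \<le> pw (- k)" using pdist_common[OF x _ xk] by blast
      then obtain u where u: "q = of_int u * rp k" using pfrac_av_le[OF q(1), of "- k"] by auto
      then have "q * rp (- k) = of_int u * (rp k * rp (- k))" by simp
      also have "rp k * rp (- k) = 1" unfolding rp_add[symmetric] by simp
      finally have "\<lfloor>q * rp (- k)\<rfloor> = u" by simp
      then show ?case using u psm_below[OF df, of "k - 1"] by simp
    next
      case (step i)
      let ?v = "q * rp (- (i + 1))"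
      have "?v / of_nat p = q * (rp (- (i + 1)) * rp (-1))" by (simp add: power_int_minus field_simps)
      also have "\<dots> = q * rp (- (i + 1 + 1))" unfolding rp_add[symmetric] by simp
      finally have f: "\<lfloor>q * rp (- (i + 1 + 1))\<rfloor> = \<lfloor>?v\<rfloor> div int p"
        using floor_divide_of_nat_eq_div[of p ?v] p_gt_0 by simp
      have "int (d (i + 1)) = \<lfloor>?v\<rfloor> mod int p"
        using dq[of "i + 1"] step.prems p_gt_0 by (simp add: qdig_def)
      then have "of_nat (d (i + 1)) = (of_int (\<lfloor>?v\<rfloor> mod int p) :: rat)" by (metis of_int_of_nat_eq)
      moreover have "rp (i + 1 + 1) = of_nat p * rp (i + 1)" by (rule rp_Suc)
      moreover have "of_int \<lfloor>?v\<rfloor> = (of_int (\<lfloor>?v\<rfloor> div int p) * of_nat p + of_int (\<lfloor>?v\<rfloor> mod int p) :: rat)"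
        by (metis div_mult_mod_eq of_int_add of_int_mult of_int_of_nat_eq)
      moreover have "psm d i = q - of_int \<lfloor>?v\<rfloor> * rp (i + 1)" using step by simp
      ultimately show ?case
        unfolding f psm_Suc[OF df] by (simp only:) (simp add: algebra_simps)
    qed
    then have "q - psm d M = of_int \<lfloor>q * rp (- (M + 1))\<rfloor> * rp (M + 1)" using M by simp
    then have "av (q - psm d M) = av (of_int \<lfloor>q * rp (- (M + 1))\<rfloor>) * pw (- (M + 1))" by (simp only: av_mult av_rp)
    also have "\<dots> \<le> 1 * pw (- (M + 1))" by (intro mult_right_mono av_of_int_le_1) simp
    finally have "pdist (pof_rat p q) (pof_rat p (psm d M)) \<le> pw (- (M + 1))" by simp
    then show ?thesis using pdist_trans[OF x pof_rat_Qp pof_rat_Qp q(2)] by blast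
  qed
  have "\<exists>N. \<forall>M\<ge>N. pdist x (pof_rat p (psm d M)) \<le> pw s" for s
  proof (intro exI allI impI)
    fix M assume "M \<ge> max (k - 1) (- s - 1)"
    then show "pdist x (pof_rat p (psm d M)) \<le> pw s" by (intro pdist_mono[OF close]) auto
  qed
  then show ?thesis using df is_std_expansion_iff by blast
qed

lemma std_expansion_pdigits:
  assumes x: "x \<in> Qp p" shows "is_std_expansion p x (pdigits p x)"
proof -
  obtain d where d: "is_std_expansion p x d" using std_expansion_exists[OF x] by blast
  have "d' = d" if "is_std_expansion p x d'" for d'
  proof
    fix j
    obtain q where "q \<in> pfrac" "pdist x (pof_rat p q) \<le> pw (- (j + 1))" using pdist_approx[OF x] by blast
    then show "d' j = d j" using std_expansion_qdig[OF x] d that by metis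
  qed
  then show ?thesis unfolding pdigits_def using d by (metis theI)
qed

text \<open>The digit sum up to index \<open>-1\<close> is itself an element of \<open>pfrac\<close>
  within distance 1 of \<open>x\<close>, so it differs from \<open>q\<close> by an integer. From
  here on the character is evaluated without digits.\<close>

lemma pchi_eq:
  assumes x: "x \<in> Qp p" and q: "q \<in> pfrac" "pdist x (pof_rat p q) \<le> 1"
  shows "pchi p x = cis (2 * pi * real_of_rat q)"
proof (cases "pabs p x \<le> 1")
  case True
  have "av (q - 0) \<le> pw 0" using q True pdist_0[OF x, of 0] by (intro pdist_common[OF x]) auto
  then have "q \<in> \<int>" using pfrac_int[OF q(1)] by simp
  then obtain u where "q = of_int u" by (auto elim: Ints_cases)
  then show ?thesis using True by (simp add: pchi_def)
next
  case False
  let ?d = "pdigits p x"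
  obtain k where k: "digits_from k ?d" using std_expansion_pdigits[OF x] is_std_expansion_iff by blast
  have "av (psm ?d (-1) - q) \<le> pw 0"
    using std_expansion_pdist[OF x std_expansion_pdigits[OF x], of "-1"] q by (intro pdist_common[OF x]) auto
  then have "psm ?d (-1) - q \<in> \<int>" using pfrac_int[OF pfrac_diff[OF psm_dyad[OF k] q(1)]] by simp
  then obtain u where "psm ?d (-1) - q = of_int u" by (auto elim: Ints_cases)
  then have "real_of_rat (psm ?d (-1)) = real_of_rat (q + of_int u)" by (metis add.commute diff_add_cancel)
  then have "2 * pi * real_of_rat (psm ?d (-1)) = 2 * pi * real_of_rat q + 2 * pi * of_int u"
    by (simp add: of_rat_add distrib_left)
  then show ?thesis using False by (simp add: pchi_def cis_mult[symmetric])
qed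

section \<open>Haar measure\<close>

definition plim :: "(int \<Rightarrow> nat) \<Rightarrow> qp" where
  "plim d = pcls p (\<lambda>n. psm d (int n))"

lemma plim_std:
  assumes d: "digits_from k d"
  shows "plim d \<in> Qp p" "is_std_expansion p (plim d) d"
proof -
  have c: "pcauchy p (\<lambda>n. psm d (int n))"
  proof (rule pcauchyI)
    fix s
    have "av (psm d (int m) - psm d (int n)) \<le> pw s" if "m \<ge> nat (- s)" "n \<ge> nat (- s)" for m n
    proof -
      have "av (psm d (int l) - psm d (int (nat (- s)))) \<le> pw s" if "l \<ge> nat (- s)" for l
      proof -
        have "av (psm d (int l) - psm d (int (nat (- s)))) \<le> pw (- (int (nat (- s)) + 1))"
          using that by (intro av_psm_diff[OF d]) (simp only: of_nat_le_iff)
        also have "\<dots> \<le> pw s" by simp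
        finally show ?thesis .
      qed
      then show ?thesis using that av_diff_trans av_minus_commute by metis
    qed
    then show "\<exists>N. \<forall>m\<ge>N. \<forall>n\<ge>N. av (psm d (int m) - psm d (int n)) \<le> pw s" by blast
  qed
  show Q: "plim d \<in> Qp p" unfolding plim_def by (rule pcls_in_Qp[OF c])
  have "pdist (plim d) (pof_rat p (psm d M)) \<le> pw (- (M + 1))" for M
  proof -
    have "\<forall>\<^sub>F n in sequentially. int n \<ge> M"
      using eventually_ge_at_top[of "nat M"] by eventually_elim auto
    then have "\<forall>\<^sub>F n in sequentially. av (psm d (int n) - psm d M) \<le> pw (- (M + 1))"
      by eventually_elim (rule av_psm_diff[OF d])
    then show ?thesis
      using pdist_le_iff[OF Q pof_rat_Qp _ pof_rat_mem] self_mem_pcls[OF c] plim_def by metis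
  qed
  then have "\<exists>N. \<forall>M\<ge>N. pdist (plim d) (pof_rat p (psm d M)) \<le> pw s" for s
    by (intro exI[of _ "- s"] allI impI) (rule pdist_mono, auto)
  then show "is_std_expansion p (plim d) d" using d is_std_expansion_iff by blast
qed

text \<open>Turns balls into sets of numbers with prescribed low digits, the form in which they are
  compared with real intervals.\<close>

lemma pdist_le_iff_digits:
  assumes x: "x \<in> Qp p" "is_std_expansion p x d" and y: "y \<in> Qp p" "is_std_expansion p y e"
  shows "pdist x y \<le> pw r \<longleftrightarrow> (\<forall>j < - r. d j = e j)"
proof
  obtain k where k: "digits_from k e" using y is_std_expansion_iff by blast
  assume xy: "pdist x y \<le> pw r"
  show "\<forall>j < - r. d j = e j"
  proof (intro allI impI)
    fix j assume j: "j < - r"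
    have "pdist x y \<le> pw (- (j + 1))" using j by (intro pdist_mono[OF xy]) simp
    then have "pdist x (pof_rat p (psm e j)) \<le> pw (- (j + 1))"
      using pdist_trans[OF x(1) y(1) pof_rat_Qp] std_expansion_pdist[OF y] by blast
    then have "d j = qdig (psm e j) j" by (rule std_expansion_qdig[OF x psm_dyad[OF k]])
    then show "d j = e j" using qdig_psm[OF k] by simp
  qed
next
  assume eq: "\<forall>j < - r. d j = e j"
  have "psm d (- r - 1) = psm e (- r - 1)"
    unfolding pdigit_sum_def using eq by (intro sum.cong) auto
  then have "pdist x (pof_rat p (psm e (- r - 1))) \<le> pw r"
    using std_expansion_pdist[OF x, of "- r - 1"] by simp
  moreover have "pdist (pof_rat p (psm e (- r - 1))) y \<le> pw r"
    using pdist_commute_le[OF y(1) pof_rat_Qp] std_expansion_pdist[OF y, of "- r - 1"] by simp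
  ultimately show "pdist x y \<le> pw r" using pdist_trans[OF x(1) pof_rat_Qp y(1)] by blast
qed

text \<open>The base-\<open>p\<close> digit of \<open>x\<close> at \<open>p powi (- j - 1)\<close>, used as the \<open>p\<close>-adic digit at \<open>p powi j\<close>.\<close>
definition mdig :: "real \<Rightarrow> int \<Rightarrow> nat" where
  "mdig x j = nat (\<lfloor>x * pw (j + 1)\<rfloor> mod int p)"

lemma pw_Suc: "pw (j + 1) = real p * pw j"
  using p_gt_0 by (intro power_int_add_1') simp

lemma int_mdig: "int (mdig x j) = \<lfloor>x * pw (j + 1)\<rfloor> mod int p"
  using p_gt_0 by (simp add: mdig_def)

lemma floor_pw_div: "\<lfloor>x * pw j\<rfloor> = \<lfloor>x * pw (j + 1)\<rfloor> div int p"
proof -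
  have "x * pw j = x * pw (j + 1) / real p" using p_gt_0 by (simp add: pw_Suc)
  then show ?thesis using floor_divide_of_nat_eq_div[OF p_gt_0] by metis
qed

lemma floor_pw_step: "\<lfloor>x * pw (j + 1)\<rfloor> = int p * \<lfloor>x * pw j\<rfloor> + int (mdig x j)"
  unfolding floor_pw_div[of x j] int_mdig by simp

lemma ex_floor_pw_0:
  assumes "x \<ge> 0" shows "\<exists>k. \<forall>j\<le>k. \<lfloor>x * pw j\<rfloor> = 0"
proof -
  obtain s where s: "x < pw s" using ex_pw_greater by blast
  have "\<lfloor>x * pw j\<rfloor> = 0" if "j \<le> - s" for j
  proof (rule floor_unique)
    have "x * pw j < pw s * pw j" using s by (intro mult_strict_right_mono) auto
    also have "\<dots> \<le> pw 0" unfolding pw_add[symmetric] using that by (simp only: pw_le_iff)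
    finally show "x * pw j < of_int 0 + 1" by simp
  qed (use assms in simp)
  then show ?thesis by blast
qed

lemma mdig_digits_from:
  assumes "x \<ge> 0" shows "\<exists>k. digits_from k (mdig x)"
proof -
  obtain k where k: "\<forall>j\<le>k. \<lfloor>x * pw j\<rfloor> = 0" using ex_floor_pw_0[OF assms] by blast
  have "digits_from k (mdig x)"
    using k p_gt_0 by (auto simp: digits_from_def mdig_def nat_less_iff)
  then show ?thesis by blast
qed

text \<open>For nonnegative reals the floors vanish at very negative indices, which starts the
  upward induction; conversely each floor determines the one below it by division by
  \<open>p\<close>.\<close>

lemma mdig_eq_iff:
  assumes "x \<ge> 0" "y \<ge> 0"
  shows "(\<forall>j<i. mdig x j = mdig y j) \<longleftrightarrow> \<lfloor>x * pw i\<rfloor> = \<lfloor>y * pw i\<rfloor>"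
proof
  assume eq: "\<forall>j<i. mdig x j = mdig y j"
  obtain k1 k2 where k: "\<forall>j\<le>k1. \<lfloor>x * pw j\<rfloor> = 0" "\<forall>j\<le>k2. \<lfloor>y * pw j\<rfloor> = 0"
    using ex_floor_pw_0 assms by meson
  define k where "k = min (min k1 k2) i"
  have "k \<le> i" by (simp add: k_def)
  then show "\<lfloor>x * pw i\<rfloor> = \<lfloor>y * pw i\<rfloor>"
    using eq
  proof (induction i rule: int_ge_induct)
    case base
    then show ?case using k by (simp add: k_def)
  next
    case (step i)
    then show ?case by (simp only: floor_pw_step) simp
  qed
next
  assume eq: "\<lfloor>x * pw i\<rfloor> = \<lfloor>y * pw i\<rfloor>"
  have *: "\<lfloor>x * pw j\<rfloor> = \<lfloor>y * pw j\<rfloor>" if "j \<le> i" for j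
    using that
  proof (induction j rule: int_le_induct)
    case base
    then show ?case using eq .
  next
    case (step j)
    then show ?case using floor_pw_div[of x "j - 1"] floor_pw_div[of y "j - 1"] by simp
  qed
  show "\<forall>j<i. mdig x j = mdig y j" using * by (simp add: mdig_def)
qed

text \<open>Only the digits below \<open>i\<close> are matched, so \<open>y\<close> is a multiple of
  a power of \<open>p\<close> built digit by digit, and the ambiguity of infinite real expansions
  never arises.\<close>

lemma mdig_surj:
  assumes e: "digits_from k e" shows "\<exists>y\<ge>0. \<forall>j<i. mdig y j = e j"
proof (cases "i \<le> k")
  case True
  then have "\<forall>j<i. mdig 0 j = e j" using e by (simp add: mdig_def digits_from_def)
  then show ?thesis by blast
next
  case False
  then have "k \<le> i" by simp
  then show ?thesis
  proof (induction i rule: int_ge_induct)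
    case base
    have "\<forall>j<k. mdig 0 j = e j" using e by (simp add: mdig_def digits_from_def)
    then show ?case by blast
  next
    case (step i)
    then obtain y where y: "y \<ge> 0" "\<forall>j<i. mdig y j = e j" by blast
    define m where "m = int p * \<lfloor>y * pw i\<rfloor> + int (e i)"
    define z where "z = of_int m * pw (- (i + 1))"
    have "m \<ge> 0" using y by (simp add: m_def)
    then have z: "z \<ge> 0" by (simp add: z_def)
    have ei: "e i < p" using e by (simp add: digits_from_def)
    have "z * pw (i + 1) = of_int m * (pw (- (i + 1)) * pw (i + 1))" by (simp only: z_def mult.assoc)
    also have "pw (- (i + 1)) * pw (i + 1) = 1" unfolding pw_add[symmetric] by simp
    finally have fz: "\<lfloor>z * pw (i + 1)\<rfloor> = m" by simp
    have "\<lfloor>z * pw i\<rfloor> = \<lfloor>y * pw i\<rfloor>"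
      unfolding floor_pw_div[of z i] fz unfolding m_def using ei by simp
    then have "\<forall>j<i. mdig z j = e j" using mdig_eq_iff[OF z y(1), of i] y by simp
    moreover have "int (mdig z i) = int (e i)" unfolding int_mdig fz m_def using ei by simp
    ultimately have "mdig z j = e j" if "j < i + 1" for j
      using that by (cases "j = i") auto
    then show ?case using z by blast
  qed
qed

text \<open>The Monna map, which carries half-open intervals to balls.\<close>
definition monna :: "real \<Rightarrow> qp" where
  "monna x = plim (mdig x)"

lemma pballI: "y \<in> Qp p \<Longrightarrow> pdist y x \<le> pw r \<Longrightarrow> y \<in> pball p x r"
  by (simp add: pball_def)

text \<open>Under reflection, prescribing the \<open>p\<close>-adic digits below \<open>- r\<close>
  prescribes the floor of \<open>x / p^r\<close>; the interval so obtained has exactly the length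
  required of the measure of the ball.\<close>

lemma monna_vimage_pball:
  assumes c: "c \<in> Qp p"
  shows "\<exists>a\<ge>0. monna -` pball p c r \<inter> {0..} = {a..<a + pw r}"
proof -
  let ?e = "pdigits p c"
  have e: "is_std_expansion p c ?e" by (rule std_expansion_pdigits[OF c])
  then obtain k where k: "digits_from k ?e" using is_std_expansion_iff by blast
  obtain y where y: "y \<ge> 0" "\<forall>j < - r. mdig y j = ?e j" using mdig_surj[OF k] by blast
  define m where "m = \<lfloor>y * pw (- r)\<rfloor>"
  have m: "m \<ge> 0" using y by (simp add: m_def)
  have "monna x \<in> pball p c r \<longleftrightarrow> of_int m * pw r \<le> x \<and> x < of_int m * pw r + pw r" if x: "x \<ge> 0" for x
  proof -
    obtain k' where k': "digits_from k' (mdig x)" using mdig_digits_from[OF x] by blast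
    note s = plim_std[OF k', folded monna_def]
    have "monna x \<in> pball p c r \<longleftrightarrow> pdist (monna x) c \<le> pw r" using s by (simp add: pball_def)
    also have "\<dots> \<longleftrightarrow> (\<forall>j < - r. mdig x j = mdig y j)"
      unfolding pdist_le_iff_digits[OF s c e] using y by auto
    also have "\<dots> \<longleftrightarrow> \<lfloor>x * pw (- r)\<rfloor> = m" unfolding mdig_eq_iff[OF x y(1)] m_def ..
    also have "\<dots> \<longleftrightarrow> of_int m \<le> x * pw (- r) \<and> x * pw (- r) < of_int m + 1" by (simp add: floor_eq_iff)
    also have "x * pw (- r) = x / pw r" by (simp add: power_int_minus divide_inverse)
    also have "of_int m \<le> x / pw r \<longleftrightarrow> of_int m * pw r \<le> x" by (simp add: pos_le_divide_eq)
    also have "x / pw r < of_int m + 1 \<longleftrightarrow> x < of_int m * pw r + pw r"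
      by (simp add: pos_divide_less_eq distrib_right)
    finally show ?thesis .
  qed
  moreover have "of_int m * pw r \<ge> 0" using m by simp
  ultimately show ?thesis by (intro exI[of _ "of_int m * pw r"]) auto
qed

lemma monna_Qp: "x \<ge> 0 \<Longrightarrow> monna x \<in> Qp p"
  using mdig_digits_from plim_std(1) unfolding monna_def by blast

section \<open>Existence and uniqueness of the Haar measure\<close>

abbreviation "pballs \<equiv> {pball p x r | x r. x \<in> Qp p}"

lemma pballs_subset: "pballs \<subseteq> Pow (Qp p)"
  by (auto simp: pball_def)

lemma pball_subset:
  assumes "x \<in> Qp p" "y \<in> Qp p" "r \<le> s" "z \<in> pball p x r" "z \<in> pball p y s"
  shows "pball p x r \<subseteq> pball p y s"
proof
  fix w assume w: "w \<in> pball p x r"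
  have Q: "w \<in> Qp p" "z \<in> Qp p" using w assms by (auto simp: pball_def)
  have "pdist w x \<le> pw s" using w assms(3) by (auto simp: pball_def intro: pdist_mono)
  moreover have "pdist x z \<le> pw s"
    using assms by (intro pdist_commute_le[OF Q(2)]) (auto simp: pball_def intro: pdist_mono)
  moreover have "pdist z y \<le> pw s" using assms by (simp add: pball_def)
  ultimately have "pdist w y \<le> pw s" using Q assms pdist_trans by meson
  then show "w \<in> pball p y s" using Q by (simp add: pball_def)
qed

definition is_haar :: "qp measure \<Rightarrow> bool" where
  "is_haar M \<longleftrightarrow> space M = Qp p \<and> sets M = sigma_sets (Qp p) pballs \<and>
     (\<forall>x\<in>Qp p. \<forall>r. emeasure M (pball p x r) = ennreal (pw r))"

text \<open>The image of Lebesgue measure on the nonnegative reals under \<open>monna\<close>: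
  measures of balls become lengths of intervals.\<close>

lemma haar_exists: "\<exists>M. is_haar M"
proof -
  let ?R = "restrict_space lborel {0::real..}"
  let ?N = "sigma (Qp p) pballs"
  have sN: "sets ?N = sigma_sets (Qp p) pballs" "space ?N = Qp p"
    using pballs_subset by (simp_all add: sets_measure_of space_measure_of)
  have vim: "\<exists>a\<ge>0. monna -` pball p c r \<inter> space ?R = {a..<a + pw r}" if "c \<in> Qp p" for c r
    using monna_vimage_pball[OF that, of r] by (simp add: space_restrict_space)
  have meas: "monna \<in> measurable ?R ?N"
  proof (rule measurable_measure_of[OF pballs_subset])
    show "monna \<in> space ?R \<rightarrow> Qp p" using monna_Qp by (auto simp: space_restrict_space)
    fix B assume "B \<in> pballs"
    then obtain c r where B: "B = pball p c r" "c \<in> Qp p" by blast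
    then obtain a where a: "a \<ge> 0" "monna -` B \<inter> space ?R = {a..<a + pw r}" using vim by blast
    show "monna -` B \<inter> space ?R \<in> sets ?R"
      unfolding a(2) using a(1) by (auto simp: sets_restrict_space_iff)
  qed
  let ?M = "distr ?R ?N monna"
  have "emeasure ?M (pball p c r) = ennreal (pw r)" if c: "c \<in> Qp p" for c r
  proof -
    obtain a where a: "a \<ge> 0" "monna -` pball p c r \<inter> space ?R = {a..<a + pw r}" using vim[OF c] by blast
    have "pball p c r \<in> sets ?N" unfolding sN using c by (intro sigma_sets.Basic) blast
    then have "emeasure ?M (pball p c r) = emeasure ?R {a..<a + pw r}"
      unfolding a(2)[symmetric] by (rule emeasure_distr[OF meas])
    also have "\<dots> = emeasure lborel {a..<a + pw r}"
      using a(1) by (intro emeasure_restrict_space) auto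
    also have "\<dots> = ennreal (pw r)" by simp
    finally show ?thesis .
  qed
  then have "is_haar ?M" using sN by (simp add: is_haar_def)
  then show ?thesis ..
qed

lemma haar_unique:
  assumes M: "is_haar M" and N: "is_haar N" shows "M = N"
proof -
  \<comment> \<open>Two balls are nested or disjoint, so adding the empty set gives a generator
    closed under intersection.\<close>
  let ?E = "insert {} pballs"
  have sig: "sigma_sets (Qp p) ?E = sigma_sets (Qp p) pballs"
    by (rule sigma_sets_eqI) (auto intro: sigma_sets.Empty sigma_sets.Basic)
  have st: "Int_stable ?E"
  proof (rule Int_stableI)
    fix a b assume a: "a \<in> ?E" and b: "b \<in> ?E"
    show "a \<inter> b \<in> ?E"
    proof (cases "a \<inter> b = {}")
      case False
      then obtain z where z: "z \<in> a" "z \<in> b" by blast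
      obtain x r where x: "a = pball p x r" "x \<in> Qp p" using a z by blast
      obtain y s where y: "b = pball p y s" "y \<in> Qp p" using b z by blast
      show ?thesis
      proof (cases "r \<le> s")
        case True
        then have "a \<inter> b = a" using pball_subset[OF x(2) y(2)] x y z by blast
        then show ?thesis using a by simp
      next
        case False
        then have "a \<inter> b = b" using pball_subset[OF y(2) x(2), of s r] x y z by force
        then show ?thesis using b by simp
      qed
    qed simp
  qed
  have cover: "(\<Union>i. pball p (pof_rat p 0) (int i)) = Qp p"
  proof
    show "Qp p \<subseteq> (\<Union>i. pball p (pof_rat p 0) (int i))"
    proof
      fix x assume x: "x \<in> Qp p"
      obtain s where s: "pabs p x \<le> pw s" using pabs_bdd[OF x] by blast
      have "pdist x (pof_rat p 0) \<le> pw (int (nat s))"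
        by (rule pdist_mono[of x _ s]) (use s x in simp_all)
      then have "x \<in> pball p (pof_rat p 0) (int (nat s))" by (rule pballI[OF x])
      then show "x \<in> (\<Union>i. pball p (pof_rat p 0) (int i))" by blast
    qed
  qed (auto simp: pball_def)
  show ?thesis
  proof (rule measure_eqI_generator_eq[OF st, of "Qp p" M N "\<lambda>i. pball p (pof_rat p 0) (int i)"])
    show "?E \<subseteq> Pow (Qp p)" using pballs_subset by blast
    show "emeasure M X = emeasure N X" if "X \<in> ?E" for X using that M N by (auto simp: is_haar_def)
    show "sets M = sigma_sets (Qp p) ?E" "sets N = sigma_sets (Qp p) ?E"
      using M N sig by (auto simp: is_haar_def)
    show "range (\<lambda>i. pball p (pof_rat p 0) (int i)) \<subseteq> ?E" using pof_rat_Qp by blast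
    show "emeasure M (pball p (pof_rat p 0) (int i)) \<noteq> \<infinity>" for i
      using M by (simp add: is_haar_def)
  qed (rule cover)
qed

lemma is_haar_haar: "is_haar (haar p)"
proof -
  have "haar p = (THE M. is_haar M)" unfolding haar_def is_haar_def ..
  moreover have "\<exists>!M. is_haar M" using haar_exists haar_unique by blast
  ultimately show ?thesis using theI'[of is_haar] by simp
qed

lemma pball_sets_haar [measurable]: "x \<in> Qp p \<Longrightarrow> pball p x r \<in> sets (haar p)"
  using is_haar_haar by (auto simp: is_haar_def intro!: sigma_sets.Basic)

lemma emeasure_haar_pball: "x \<in> Qp p \<Longrightarrow> emeasure (haar p) (pball p x r) = ennreal (pw r)"
  using is_haar_haar by (simp add: is_haar_def)

section \<open>Reduction of the integral to an exponential sum\<close>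

lemma av_of_int_le_iff: "av (of_int d) \<le> pw (- int K) \<longleftrightarrow> int p ^ K dvd d"
proof (cases "d = 0")
  case False
  then show ?thesis
    using p_gt_1 by (simp add: av_of_int power_dvd_iff_le_multiplicity)
qed simp

lemma pfrac_common_finite:
  assumes "finite I" "\<And>i. i \<in> I \<Longrightarrow> b i \<in> pfrac"
  shows "\<exists>e0. \<forall>e\<ge>e0. \<forall>i\<in>I. \<exists>u. b i = of_int u / of_nat p ^ e"
  using assms
proof (induction I rule: finite_induct)
  case (insert i I)
  then obtain e1 where e1: "\<forall>e\<ge>e1. \<forall>i\<in>I. \<exists>u. b i = of_int u / of_nat p ^ e" by auto
  obtain e2 where e2: "\<And>e. e \<ge> e2 \<Longrightarrow> \<exists>u. b i = of_int u / of_nat p ^ e"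
    using pfrac_common[of "b i"] insert by blast
  show ?case by (rule exI[of _ "max e1 e2"]) (use e1 e2 in auto)
qed simp

lemma av_power_le:
  assumes "av x \<le> pw h" shows "av (x ^ k) \<le> pw (int k * h)"
  by (induction k) (use av_mult_le[OF assms] in \<open>simp_all add: distrib_right\<close>)

lemma av_power_diff_le:
  assumes "av x \<le> pw h" "av y \<le> pw h" "h \<ge> 0" "av (x - y) \<le> pw d" "i \<le> n"
  shows "av (x ^ i - y ^ i) \<le> pw (d + int n * h)"
proof -
  have "av (\<Sum>j<i. y ^ (i - Suc j) * x ^ j) \<le> pw (int n * h)"
  proof (rule av_sum_le)
    fix j assume j: "j \<in> {..<i}"
    have "av (y ^ (i - Suc j) * x ^ j) \<le> pw (int (i - Suc j) * h + int j * h)"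
      by (intro av_mult_le av_power_le assms)
    also have "\<dots> \<le> pw (int n * h)"
      unfolding pw_le_iff distrib_right[symmetric] using j assms by (intro mult_right_mono) auto
    finally show "av (y ^ (i - Suc j) * x ^ j) \<le> pw (int n * h)" .
  qed
  then show ?thesis unfolding power_diff_sumr2 using assms(4) by (rule av_mult_le[rotated])
qed

text \<open>Since \<open>p^(-r)\<close> has absolute value \<open>p^r\<close>, the centres
  \<open>c t\<close> and \<open>c t'\<close> are within \<open>p^(r-K)\<close> exactly when
  \<open>t\<close> and \<open>t'\<close> agree modulo \<open>p^K\<close>.\<close>

lemma pball_partition:
  assumes x0: "x0 \<in> Qp p" and q0: "q0 \<in> pfrac" "pdist x0 (pof_rat p q0) \<le> pw r"
  defines "c \<equiv> (\<lambda>t. q0 + of_nat t * rp (- r))"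
  shows "x \<in> pball p x0 r \<longleftrightarrow> (\<exists>t<p ^ K. x \<in> pball p (pof_rat p (c t)) (r - int K))"
    and "\<And>t t'. t < p ^ K \<Longrightarrow> t' < p ^ K \<Longrightarrow> x \<in> pball p (pof_rat p (c t)) (r - int K) \<Longrightarrow>
      x \<in> pball p (pof_rat p (c t')) (r - int K) \<Longrightarrow> t = t'"
proof -
  have av: "av (of_int u * rp (- r)) \<le> pw (r - int k) \<longleftrightarrow> int p ^ k dvd u" for u k
  proof -
    have "av (of_int u * rp (- r)) \<le> pw (r - int k) \<longleftrightarrow> av (of_int u) * pw r \<le> pw (- int k) * pw r"
      unfolding pw_add[symmetric] by (simp add: av_mult)
    also have "\<dots> \<longleftrightarrow> av (of_int u) \<le> pw (- int k)" by (simp only: mult_le_cancel_right_pos pw_pos)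
    finally show ?thesis unfolding av_of_int_le_iff .
  qed
  show "x \<in> pball p x0 r \<longleftrightarrow> (\<exists>t<p ^ K. x \<in> pball p (pof_rat p (c t)) (r - int K))"
  proof
    assume "x \<in> pball p x0 r"
    then have x: "x \<in> Qp p" "pdist x x0 \<le> pw r" by (auto simp: pball_def)
    obtain q where q: "q \<in> pfrac" "pdist x (pof_rat p q) \<le> pw (r - int K)" using pdist_approx[OF x(1)] by blast
    have "pdist x (pof_rat p q0) \<le> pw r" using pdist_trans[OF x(1) x0 pof_rat_Qp x(2) q0(2)] .
    moreover have "pdist x (pof_rat p q) \<le> pw r" by (rule pdist_mono[OF q(2)]) simp
    ultimately have "av (q - q0) \<le> pw r" using pdist_common[OF x(1)] by blast
    then obtain u where u: "q - q0 = of_int u * rp (- r)" using pfrac_av_le[OF pfrac_diff[OF q(1) q0(1)]] by blast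
    define t where "t = nat (u mod int p ^ K)"
    have pK: "int p ^ K > 0" using p_gt_0 by simp
    have t: "int t = u mod int p ^ K" using pK by (simp add: t_def)
    have "int t < int (p ^ K)" unfolding t using pK by simp
    then have tK: "t < p ^ K" by (simp only: of_nat_less_iff)
    have "(of_nat t :: rat) = of_int (int t)" by simp
    then have "q - c t = of_int (u - int t) * rp (- r)" using u by (simp add: c_def algebra_simps)
    moreover have "int p ^ K dvd u - int t" unfolding t by (simp add: minus_mod_eq_mult_div)
    ultimately have "av (q - c t) \<le> pw (r - int K)" by (simp only: av)
    then have "pdist (pof_rat p q) (pof_rat p (c t)) \<le> pw (r - int K)" by simp
    then have "pdist x (pof_rat p (c t)) \<le> pw (r - int K)"
      using pdist_trans[OF x(1) pof_rat_Qp pof_rat_Qp q(2)] by blast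
    then show "\<exists>t<p ^ K. x \<in> pball p (pof_rat p (c t)) (r - int K)" using tK pballI[OF x(1)] by blast
  next
    assume "\<exists>t<p ^ K. x \<in> pball p (pof_rat p (c t)) (r - int K)"
    then obtain t where x: "x \<in> Qp p" "pdist x (pof_rat p (c t)) \<le> pw (r - int K)" by (auto simp: pball_def)
    have "pdist x (pof_rat p (c t)) \<le> pw r" by (rule pdist_mono[OF x(2)]) simp
    moreover have "pdist (pof_rat p (c t)) (pof_rat p q0) \<le> pw r"
      using av[of "int t" 0] by (simp add: c_def)
    ultimately have "pdist x (pof_rat p q0) \<le> pw r" using pdist_trans[OF x(1)] pof_rat_Qp by blast
    then have "pdist x x0 \<le> pw r"
      using pdist_trans[OF x(1) pof_rat_Qp x0] pdist_commute_le[OF x0 pof_rat_Qp q0(2)] by blast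
    then show "x \<in> pball p x0 r" by (rule pballI[OF x(1)])
  qed
  fix t t' assume t: "t < p ^ K" "t' < p ^ K" "x \<in> pball p (pof_rat p (c t)) (r - int K)"
    "x \<in> pball p (pof_rat p (c t')) (r - int K)"
  then have "x \<in> Qp p" "pdist x (pof_rat p (c t)) \<le> pw (r - int K)"
    "pdist x (pof_rat p (c t')) \<le> pw (r - int K)" by (simp_all add: pball_def)
  then have "av (c t - c t') \<le> pw (r - int K)" by (rule pdist_common)
  moreover have "c t - c t' = of_int (int t - int t') * rp (- r)" by (simp add: c_def algebra_simps)
  ultimately have d: "int p ^ K dvd int t - int t'" by (simp only: av)
  have "\<bar>int t - int t'\<bar> < int (p ^ K)" using t(1,2) by linarith
  then show "t = t'" using d zdvd_not_zless[of "\<bar>int t - int t'\<bar>" "int p ^ K"] by fastforce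
qed

lemma set_integral_pball:
  fixes f :: "qp \<Rightarrow> 'a::{banach, second_countable_topology}"
  assumes x0: "x0 \<in> Qp p" and q0: "q0 \<in> pfrac" "pdist x0 (pof_rat p q0) \<le> pw r"
  defines "c \<equiv> (\<lambda>t. q0 + of_nat t * rp (- r))"
  assumes f: "\<And>t x. t < p ^ K \<Longrightarrow> x \<in> pball p (pof_rat p (c t)) (r - int K) \<Longrightarrow> f x = e t"
  shows "set_lebesgue_integral (haar p) (pball p x0 r) f = pw (r - int K) *\<^sub>R (\<Sum>t<p ^ K. e t)"
proof -
  let ?B = "\<lambda>t. pball p (pof_rat p (c t)) (r - int K)"
  have "q0 + of_nat t * rp (- r) = c t" for t by (simp add: c_def)
  note part = pball_partition[OF x0 q0, unfolded this]
  have pt: "indicator (pball p x0 r) x *\<^sub>R f x = (\<Sum>t<p ^ K. indicator (?B t) x *\<^sub>R e t)" for x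
  proof (cases "x \<in> pball p x0 r")
    case True
    then obtain t where t: "t < p ^ K" "x \<in> ?B t" using part(1) by blast
    have "(\<Sum>s<p ^ K. indicator (?B s) x *\<^sub>R e s) = (\<Sum>s<p ^ K. if s = t then e t else 0)"
      using t part(2) by (intro sum.cong refl) (auto simp: indicator_def)
    also have "\<dots> = f x" using t f by simp
    finally show ?thesis using True by simp
  next
    case False
    then have "x \<notin> ?B t" if "t < p ^ K" for t using that part(1) by blast
    then show ?thesis using False by (simp add: indicator_def)
  qed
  have em: "emeasure (haar p) (?B t) = ennreal (pw (r - int K))" for t by (rule emeasure_haar_pball) simp
  have int: "integrable (haar p) (\<lambda>x. indicator (?B t) x :: real)" for t
    by (intro integrable_real_indicator pball_sets_haar) (simp_all only: pof_rat_Qp em infinity_ennreal_def ennreal_less_top)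
  have each: "(LINT x|haar p. indicator (?B t) x *\<^sub>R e t) = pw (r - int K) *\<^sub>R e t" for t
  proof -
    have "(LINT x|haar p. indicator (?B t) x *\<^sub>R e t) = (LINT x|haar p. indicator (?B t) x) *\<^sub>R e t"
      using int by (intro integral_scaleR_left)
    also have "(LINT x|haar p. indicator (?B t) x) = measure (haar p) (?B t \<inter> space (haar p))" by simp
    also have "?B t \<inter> space (haar p) = ?B t" using is_haar_haar by (auto simp: is_haar_def pball_def)
    also have "measure (haar p) (?B t) = pw (r - int K)" unfolding measure_def em by simp
    finally show ?thesis .
  qed
  have "(LINT x|haar p. (\<Sum>t<p ^ K. indicator (?B t) x *\<^sub>R e t))
      = (\<Sum>t<p ^ K. LINT x|haar p. indicator (?B t) x *\<^sub>R e t)"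
    by (rule Bochner_Integration.integral_sum) (use int in auto)
  then show ?thesis unfolding set_lebesgue_integral_def pt by (simp only: each scaleR_sum_right)
qed

theorem integral_pchi_ppoly_bound:
  assumes n: "n \<ge> 1" and x0: "x0 \<in> Qp p" and a: "\<And>i. i \<le> n \<Longrightarrow> a i \<in> Qp p"
    and an: "a n \<noteq> pof_rat p 0"
  shows "cmod (set_lebesgue_integral (haar p) (pball p x0 r) (\<lambda>x. pchi p (ppoly p a n x)))
     \<le> real p ^ n / pabs p (a n) powr (1 / real n)"
proof -
  obtain s where s: "pabs p (a n) = pw s" "\<forall>\<^sub>F m in sequentially. av (prep (a n) m) = pw s"
  proof -
    have "\<not> pnull p (prep (a n))"
    proof
      assume "pnull p (prep (a n))"
      then have "pcls p (prep (a n)) = pof_rat p 0" unfolding pof_rat_def by (intro pcls_eqI) simp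
      then show False using an Qp_memD(2)[OF a prep_mem[OF a]] by simp
    qed
    then show ?thesis using that pabs_cases[OF a prep_mem[OF a], of n] by auto
  qed
  obtain h0 where h0: "pabs p x0 \<le> pw h0" using pabs_bdd[OF x0] by blast
  define h where "h = max (max h0 r) 0"
  have h: "h \<ge> 0" "h0 \<le> h" "r \<le> h" by (auto simp: h_def)
  \<comment> \<open>The first bound makes the effect of replacing \<open>a i\<close> by
    \<open>b i\<close> integral on the ball, where \<open>\<bar>x\<bar> \<le> p^h\<close>; the
    second lies strictly below the size of \<open>a n\<close>, so \<open>b n\<close> has the same
    absolute value.\<close>
  define \<delta> where "\<delta> = min (- (int n * h)) (s - 1)"
  have "\<forall>i\<in>{..n}. \<exists>q. q \<in> pfrac \<and> pdist (a i) (pof_rat p q) \<le> pw \<delta>" using pdist_approx a by blast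
  then obtain b where b: "\<And>i. i \<le> n \<Longrightarrow> b i \<in> pfrac \<and> pdist (a i) (pof_rat p (b i)) \<le> pw \<delta>"
    using bchoice[of "{..n}" "\<lambda>i q. q \<in> pfrac \<and> pdist (a i) (pof_rat p q) \<le> pw \<delta>"] by auto
  have ab: "\<forall>\<^sub>F m in sequentially. av (prep (a i) m - b i) \<le> pw \<delta>" if "i \<le> n" for i
    using b[OF that] pdist_le_iff[OF a[OF that] pof_rat_Qp prep_mem[OF a[OF that]] pof_rat_mem] by blast
  have bn: "av (b n) = pw s"
  proof -
    have "\<forall>\<^sub>F m in sequentially. av (b n) = pw s"
      using s(2) ab[OF order_refl]
    proof eventually_elim
      case (elim m)
      have "pw \<delta> < pw s" unfolding not_le[symmetric] pw_le_iff by (simp add: \<delta>_def)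
      then show ?case using elim av_eq_of_diff_less[of "prep (a n) m" "b n"] by simp
    qed
    then show ?thesis by simp
  qed
  obtain g where g: "(\<Sum>i\<le>n. av (b i)) < pw g" using ex_pw_greater by blast
  have bg: "av (b i) \<le> pw g" if "i \<le> n" for i
    using g member_le_sum[of i "{..n}" "\<lambda>i. av (b i)"] that by simp
  obtain q0 where q0: "q0 \<in> pfrac" "pdist x0 (pof_rat p q0) \<le> pw r" using pdist_approx[OF x0] by blast
  obtain e1 where e1: "\<forall>e\<ge>e1. \<forall>i\<in>{..n}. \<exists>u. b i = of_int u / of_nat p ^ e"
    using pfrac_common_finite[of "{..n}" b] b by auto
  obtain e2 where e2: "\<And>e. e \<ge> e2 \<Longrightarrow> \<exists>u. q0 = of_int u / of_nat p ^ e" using pfrac_common[OF q0(1)] by blast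
  \<comment> \<open>A common denominator exponent for all \<open>b i\<close> and \<open>q0\<close>;
    \<open>E \<ge> r\<close> makes \<open>M = E - r\<close> a natural number, with
    \<open>p^(-r) = p^M / p^E\<close>.\<close>
  define E where "E = max (max e1 e2) (nat r)"
  have "e2 \<le> E" by (simp add: E_def)
  obtain B where B: "\<And>i. i \<le> n \<Longrightarrow> b i = of_int (B i) / of_nat p ^ E"
    using bchoice[of "{..n}" "\<lambda>i u. b i = of_int u / of_nat p ^ E"] e1 by (auto simp: E_def)
  obtain Q where Q: "q0 = of_int Q / of_nat p ^ E" using e2 \<open>e2 \<le> E\<close> by blast
  define M where "M = nat (int E - r)"
  have "nat r \<le> E" by (simp add: E_def)
  then have M: "int M = int E - r" by (simp add: M_def)
  \<comment> \<open>Each \<open>b i\<close> brings the denominator \<open>p^E\<close> and each of at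
    most \<open>n\<close> factors \<open>c t\<close> another one. Terms of lower degree are filled
    up by \<open>p^(E * (n - i))\<close> in \<open>P0\<close>.\<close>
  define N where "N = E * (n + 1)"
  \<comment> \<open>\<open>N \<le> K\<close> is required by \<open>expsum_bound\<close>; the other
    bound ensures that replacing \<open>x\<close> by the centre \<open>c t\<close> changes the
    polynomial by at most 1 in absolute value.\<close>
  define K where "K = max N (nat (r + int n * h + g))"
  define P0 where "P0 = (\<Sum>i\<le>n. monom (B i * int p ^ (E * (n - i))) i)"
  define P where "P = P0 \<circ>\<^sub>p [:Q, int p ^ M:]"
  define c where "c = (\<lambda>t. q0 + of_nat t * rp (- r))"
  have pE: "(of_nat p :: rat) ^ k \<noteq> 0" for k using p_gt_0 by simp
  have rpr: "rp (- r) = of_nat p ^ M / of_nat p ^ E"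
  proof -
    have "rp (- r) = rp (int M - int E)" using M by simp
    then show ?thesis using p_gt_0 by (simp add: power_int_diff)
  qed
  have c: "c t = of_int (Q + int p ^ M * int t) / of_nat p ^ E" for t
    by (simp add: c_def Q rpr add_divide_distrib)
  have val: "(\<Sum>i\<le>n. b i * c t ^ i) = of_int (poly P (int t)) / of_nat p ^ N" for t
  proof -
    let ?Y = "Q + int p ^ M * int t"
    have "b i * c t ^ i = of_int (B i * int p ^ (E * (n - i)) * ?Y ^ i) / of_nat p ^ N" if "i \<le> n" for i
    proof -
      have "N = E + (E * i + E * (n - i))"
        using that by (simp add: N_def add_mult_distrib2[symmetric])
      then have pN: "(of_nat p :: rat) ^ N = of_nat p ^ E * ((of_nat p ^ E) ^ i * of_nat p ^ (E * (n - i)))"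
        by (simp add: power_add power_mult)
      show ?thesis unfolding B[OF that] c power_divide pN using pE by simp
    qed
    then have "(\<Sum>i\<le>n. b i * c t ^ i) = (\<Sum>i\<le>n. of_int (B i * int p ^ (E * (n - i)) * ?Y ^ i) / of_nat p ^ N)"
      by (intro sum.cong) auto
    also have "\<dots> = of_int (\<Sum>i\<le>n. B i * int p ^ (E * (n - i)) * ?Y ^ i) / of_nat p ^ N"
      by (simp only: sum_divide_distrib of_int_sum)
    also have "(\<Sum>i\<le>n. B i * int p ^ (E * (n - i)) * ?Y ^ i) = poly P (int t)"
      by (simp add: P_def P0_def poly_pcompose poly_sum poly_monom mult.commute)
    finally show ?thesis .
  qed
  have Bn: "B n \<noteq> 0" using bn B[of n] p_gt_0 by auto
  have "coeff P0 k = (if k \<le> n then B k * int p ^ (E * (n - k)) else 0)" for k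
    by (simp add: P0_def coeff_sum coeff_monom if_distrib cong: if_cong)
  then have P0: "degree P0 = n" "lead_coeff P0 = B n"
  proof -
    assume co: "\<And>k. coeff P0 k = (if k \<le> n then B k * int p ^ (E * (n - k)) else 0)"
    show "degree P0 = n" using Bn by (intro antisym degree_le le_degree) (auto simp: co)
    then show "lead_coeff P0 = B n" by (simp add: co)
  qed
  have degP: "degree P = n" using P0 p_gt_0 by (simp add: P_def degree_pcompose)
  have "lead_coeff P = B n * (int p ^ M) ^ n"
    unfolding P_def using p_gt_0 by (subst lead_coeff_comp) (simp_all add: P0(1) P0(2)[unfolded P0(1)])
  then have mult: "multiplicity (int p) (lead_coeff P) = multiplicity (int p) (B n) + M * n"
    using Bn p_gt_0 prime_elem_int prime_int
    by (simp add: prime_elem_multiplicity_mult_distrib power_mult[symmetric] multiplicity_same_power not_prime_unit)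
  have sE: "s = int E - int (multiplicity (int p) (B n))"
  proof -
    have "b n = of_int (B n) / of_int (int p ^ E)" using B[of n] by simp
    then have "pw s = pw (int E - int (multiplicity (int p) (B n)))"
      using bn av_quotient[OF Bn, of "int p ^ E"] p_gt_0 prime_int
      by (simp add: multiplicity_same_power not_prime_unit del: of_int_power)
    then show ?thesis by (metis order_antisym order_refl pw_le_iff)
  qed
  have chi: "pchi p (ppoly p a n x) = unity_char p N (poly P (int t))"
    if x: "x \<in> pball p (pof_rat p (c t)) (r - int K)" and t: "t < p ^ K" for x t
  proof -
    have xQ: "x \<in> Qp p" "pdist x (pof_rat p (c t)) \<le> pw (r - int K)" using x by (auto simp: pball_def)
    have xB: "x \<in> pball p x0 r"
      using pball_partition(1)[OF x0 q0, of x K] x t unfolding c_def by blast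
    have "pabs p x \<le> pw h"
    proof -
      have "pdist x x0 \<le> pw r" using xB by (simp add: pball_def)
      then have "pdist x x0 \<le> pw h" by (rule pdist_mono) (rule h)
      moreover have "pdist x0 (pof_rat p 0) \<le> pw h"
        using h0 x0 by (intro pdist_mono[OF _ h(2)]) simp
      ultimately have "pdist x (pof_rat p 0) \<le> pw h" using pdist_trans[OF xQ(1) x0 pof_rat_Qp] by blast
      then show ?thesis using xQ by simp
    qed
    then have xh: "\<forall>\<^sub>F m in sequentially. av (prep x m) \<le> pw h"
      using pabs_le_iff[OF xQ(1) prep_mem[OF xQ(1)]] by blast
    have xc: "\<forall>\<^sub>F m in sequentially. av (prep x m - c t) \<le> pw (r - int K)"
      using xQ pdist_le_iff[OF xQ(1) pof_rat_Qp prep_mem[OF xQ(1)] pof_rat_mem] by blast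
    have all: "\<forall>\<^sub>F m in sequentially. \<forall>i\<in>{..n}. av (prep (a i) m - b i) \<le> pw \<delta>"
      using ab by (intro eventually_ball_finite) auto
    have K: "g + ((r - int K) + int n * h) \<le> 0" by (simp add: K_def)
    have "\<forall>\<^sub>F m in sequentially. av ((\<Sum>i\<le>n. prep (a i) m * prep x m ^ i) - (\<Sum>i\<le>n. b i * c t ^ i)) \<le> pw 0"
      using xh xc all
    proof eventually_elim
      case (elim m)
      let ?x = "prep x m"
      have "av (c t) \<le> pw h"
      proof -
        have "r - int K \<le> h" using h by simp
        then have "av (?x - c t) \<le> pw h" using elim(2) by (meson order_trans pw_le_iff)
        then show ?thesis using av_diff_le[of ?x h "?x - c t"] elim(1) by simp
      qed
      show ?case
        unfolding sum_subtractf[symmetric]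
      proof (rule av_sum_le)
        fix i assume i: "i \<in> {..n}"
        have "av (?x ^ i - c t ^ i) \<le> pw ((r - int K) + int n * h)"
          using elim \<open>av (c t) \<le> pw h\<close> h i by (intro av_power_diff_le) auto
        then have "av (b i * (?x ^ i - c t ^ i)) \<le> pw (g + ((r - int K) + int n * h))"
          using i by (intro av_mult_le bg) auto
        also have "\<dots> \<le> pw 0" using K by (simp only: pw_le_iff)
        finally have 1: "av (b i * (?x ^ i - c t ^ i)) \<le> pw 0" .
        have "av (?x ^ i) \<le> pw (int n * h)"
        proof (rule order_trans[OF av_power_le[OF elim(1)]])
          show "pw (int i * h) \<le> pw (int n * h)"
            unfolding pw_le_iff using i h by (intro mult_right_mono) auto
        qed
        then have "av ((prep (a i) m - b i) * ?x ^ i) \<le> pw (\<delta> + int n * h)"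
          using elim(3) i by (intro av_mult_le) auto
        also have "\<dots> \<le> pw 0" by (simp only: pw_le_iff) (simp add: \<delta>_def)
        finally have "av ((prep (a i) m - b i) * ?x ^ i + b i * (?x ^ i - c t ^ i)) \<le> pw 0"
          using 1 by (rule av_add_le)
        then show "av (prep (a i) m * ?x ^ i - b i * c t ^ i) \<le> pw 0" by (simp add: algebra_simps)
      qed
    qed
    moreover have "ppoly p a n x \<in> Qp p \<and> (\<lambda>m. \<Sum>i\<le>n. prep (a i) m * prep x m ^ i) \<in> ppoly p a n x"
      by (rule ppoly_mem) (use a xQ prep_mem in auto)
    ultimately have "pdist (ppoly p a n x) (pof_rat p (\<Sum>i\<le>n. b i * c t ^ i)) \<le> pw 0"
      using pdist_le_iff[OF _ pof_rat_Qp _ pof_rat_mem] by blast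
    then have "pchi p (ppoly p a n x) = cis (2 * pi * real_of_rat (of_int (poly P (int t)) / of_nat p ^ N))"
      using \<open>ppoly p a n x \<in> Qp p \<and> _\<close> unfolding val by (intro pchi_eq pfracI) auto
    then show ?thesis by (simp add: unity_char_def of_rat_divide of_rat_power)
  qed
  have "set_lebesgue_integral (haar p) (pball p x0 r) (\<lambda>x. pchi p (ppoly p a n x))
      = pw (r - int K) *\<^sub>R expsum p N K P"
    unfolding expsum_def using chi by (intro set_integral_pball[OF x0 q0]) (simp add: c_def)
  then have "cmod (set_lebesgue_integral (haar p) (pball p x0 r) (\<lambda>x. pchi p (ppoly p a n x)))
      = pw (r - int K) * cmod (expsum p N K P)" by simp
  also have "\<dots> \<le> pw (r - int K) * (real p ^ K * real p ^ n
      * real p powr ((real (multiplicity (int p) (lead_coeff P)) - real N) / real n))"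
    using expsum_bound[OF prime degP n, of N K] by (intro mult_left_mono) (auto simp: K_def)
  \<comment> \<open>The auxiliary \<open>E\<close> cancels: the valuation is
    \<open>(E - s) + (E - r) * n\<close> and \<open>N = E * (n + 1)\<close>, leaving
    \<open>- s - r * n\<close>. The term \<open>- r\<close> in the quotient then cancels the size of
    the ball, so the bound does not depend on the radius.\<close>
  also have "(real (multiplicity (int p) (lead_coeff P)) - real N) / real n = - (of_int s / real n) - of_int r"
  proof -
    have "real M = real E - of_int r" using arg_cong[OF M, of real_of_int] by simp
    then have "real M * real n = real E * real n - of_int r * real n" by (simp add: left_diff_distrib)
    then have "real (multiplicity (int p) (lead_coeff P)) - real N = - of_int s - of_int r * real n"
      unfolding mult N_def sE by (simp add: distrib_left)
    then show ?thesis using n by (simp add: field_simps)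
  qed
  also have "pw (r - int K) * (real p ^ K * real p ^ n * real p powr (- (of_int s / real n) - of_int r))
      = real p ^ n * (real p powr (of_int r - real K) * real p powr real K * real p powr (- (of_int s / real n) - of_int r))"
    using p_gt_0 powr_real_of_int'[of "real p" "r - int K"] by (simp add: powr_realpow)
  also have "\<dots> = real p ^ n * real p powr (- (of_int s / real n))"
    by (simp add: powr_add[symmetric])
  also have "\<dots> = real p ^ n / pabs p (a n) powr (1 / real n)"
    using p_gt_0 powr_real_of_int'[of "real p" s] unfolding s(1)
    by (simp add: powr_minus divide_inverse powr_powr[symmetric])
  finally show ?thesis .
qed

end

theorem mainTheorem3:
  fixes p n :: nat and x0 :: qp and a :: "nat \<Rightarrow> qp" and r :: int
  assumes "prime p" and "n \<ge> 1"
    and "x0 \<in> Qp p" and "\<forall>i\<le>n. a i \<in> Qp p" and "a n \<noteq> pof_rat p 0"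
  shows "cmod (set_lebesgue_integral (haar p) (pball p x0 r) (\<lambda>x. pchi p (ppoly p a n x)))
           \<le> 2 * real p ^ n / (pabs p (a n)) powr (1 / real n)"
proof -
  interpret padic p by standard (rule assms(1))
  have "cmod (set_lebesgue_integral (haar p) (pball p x0 r) (\<lambda>x. pchi p (ppoly p a n x)))
      \<le> real p ^ n / pabs p (a n) powr (1 / real n)"
    using assms by (intro integral_pchi_ppoly_bound) auto
  \<comment> \<open>The argument yields the constant 1; the factor 2 enters only here.\<close>
  also have "\<dots> \<le> 2 * real p ^ n / pabs p (a n) powr (1 / real n)"
    by (intro divide_right_mono) auto
  finally show ?thesis .
qed

end
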